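(* In both the acoustic case and the electromagnetic case described in the context, the adjoint $A^{*}:\hat Z\to Z$ of the communication operator $A:Z\to\hat Z$ (with respect to the inner products of $Z$ and $\hat Z$) satisfies $$A^{*}\,=\,\mathcal T\,B\,\hat{\mathcal T},$$ where $B:\hat Z\to Z$ is the reverse communication operator and $\mathcal T,\hat{\mathcal T}$ are the time-reversal mirrors ($\mathcal T=\mathcal T_a$, $\hat{\mathcal T}=\hat{\mathcal T}_a$ in the acoustic case; $\mathcal T=\mathcal T_e$, $\hat{\mathcal T}=\hat{\mathcal T}_e$ in the electromagnetic case).
   Context: Systems. Let $\Omega\subset\mathbb R^3$ be a domain and $T>0$. (Acoustic case) $N=4$, $u=(v,p)^T$, $q=(q_v,q_p)^T$ with $v,q_v$ being $\mathbb R^3$-valued and $p,q_p$ real-valued; $\rho(x)\,\partial_t v+\operatorname{grad}p=q_v$, $\kappa(x)\,\partial_t p+\operatorname{div}v=q_p$, $v(x,0)=0$, $p(x,0)=0$; $\Gamma(x)=\mathrm{diag}(\rho,\rho,\rho,\kappa)$. (Electromagnetic case) $N=6$, $u=(E,H)^T$, $q=(q_E,q_H)^T$ with all of $E,H,q_E,q_H$ being $\mathbb R^3$-valued; $\epsilon(x)\,\partial_tE-\operatorname{curl}H+\sigma(x)E=q_E$, $\mu(x)\,\partial_tH+\operatorname{curl}E=q_H$, $E(x,0)=0$, $H(x,0)=0$; $\epsilon,\mu$ are symmetric positive definite $3\times3$ matrices, $\sigma$ is a symmetric positive semi-definite $3\times 3$ matrix; $\Gamma(x)=\mathrm{diag}(\epsilon,\mu)$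 (block diagonal). In both cases $\Gamma$ is real, symmetric, bounded and uniformly positive definite. Spaces. $U=\{u\in L^2(\Omega\times[0,T])^N: u=0 \text{ on }\partial\Omega\times[0,T],\ \|u\|_U<\infty\}$ with $\langle u,w\rangle_U=\int_0^T\int_\Omega\langle\Gamma(x)u(x,t),w(x,t)\rangle_N\,dx\,dt$, where $\langle\cdot,\cdot\rangle_N$ is the Euclidean inner product of $\mathbb R^N$. With $J$ users and $K$ base antennas, $\hat Z=(L_2([0,T])^N)^J$ and $Z=(L_2([0,T])^N)^K$, with $\langle s^{(1)},s^{(2)}\rangle_{\hat Z}=\sum_{j=1}^J\int_0^T\langle s^{(1)}_j,s^{(2)}_j\rangle_N dt$ and $\langle r^{(1)},r^{(2)}\rangle_{Z}=\sum_{k=1}^K\int_0^T\langle r^{(1)}_k,r^{(2)}_k\rangle_N dt$. The same notation is used for the corresponding spaces on the time interval $[T,2T]$. Source and measurement operators. $\hat\gamma_j$ $(1\le j\le J)$ and $\gamma_k$ $(1\le k\le K)$ are real scalar functions in $L_2(\Omega)$, supported in pairwise disjoint small neighbourhoods of the user and antenna locations in $\Omega$. Set $(\hat Qs)(x,t)=\sum_{j}\hat\gamma_j(x)s_j(t)$, $(Qr)(x,t)=\sum_k\gamma_k(x)r_k(t)$, $(\hat Mu)_j(t)=\int_\Omega\hat\gamma_j(x)u(x,t)\,dx$, $(Mu)_k(t)=\int_\Omega\gamma_k(x)u(x,t)\,dx$; so $\hat Q:\hat Z\to U$, $Q:Z\to U$, $\hat M:U\to\hat Z$, $M:U\to Z$.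 Solution operator. $F:U\to U$, $Fq=u$, where $u$ solves the following initial value problem on $\Omega\times[0,T]$ with source $q$: in the acoustic case, $u=(v,p)^T$ with $\rho\,\partial_t v+\operatorname{grad}p=q_v$, $\kappa\,\partial_t p+\operatorname{div}v=q_p$, $v(x,0)=0$, $p(x,0)=0$; in the electromagnetic case, $u=(E,H)^T$ with $\epsilon\,\partial_tE-\operatorname{curl}H+\sigma E=q_E$, $\mu\,\partial_tH+\operatorname{curl}E=q_H$, $E(x,0)=0$, $H(x,0)=0$. On the interval $[T,2T]$, $F$ denotes the same solution operator with zero initial values at $t=T$. Standing assumptions: all coefficients, sources and fields are sufficiently regular that integration by parts and Green's formulas apply; $\partial\Omega$ is so far from the users and antennas that no energy reaches it in $[0,T]$ (or $[T,2T]$), i.e. all fields under consideration (solutions of the forward system, and of the corresponding adjoint, backward-in-time system) vanish on $\partial\Omega$; $F$ is then well defined. Communication operators. $A=\hat MFQ:Z\to\hat Z$ and $B=MF\hat Q:\hat Z\to Z$. Time-reversal mirrors. They map signals on $[0,T]$ to signals on $[T,2T]$ and vice versa. Acoustic: for $r=(r_v,r_p)^T\in Z$ and $s=(s_v,s_p)^T\in\hat Z$ (splitting the $N$-vector at each antenna/user into velocity and pressure parts), $(\mathcal T_ar)(t)=(-r_v(2T-t),\,r_p(2T-t))^T$ and $(\hat{\mathcal T}_as)(t)=(-s_v(2T-t),\,s_p(2T-t))^T$. Electromagnetic: for $r=(r_E,r_H)^T$, $s=(s_E,s_H)^T$, $(\mathcal T_er)(t)=(-r_E(2T-t),\,r_H(2T-t))^T$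 and $(\hat{\mathcal T}_es)(t)=(-s_E(2T-t),\,s_H(2T-t))^T$. In the product $\mathcal TB\hat{\mathcal T}$, $\hat{\mathcal T}$ maps signals on $[0,T]$ to $[T,2T]$, $B$ acts on $[T,2T]$, and $\mathcal T$ maps back to $[0,T]$. *)

theory Defs
  imports "HOL-Analysis.Analysis"
begin

(* Fields are written u x t with x in R^3. Acoustic states (v, p) have type (real^3) * real (N = 4),
   electromagnetic states (E, H) have type (real^3) * (real^3) (N = 6); the inner product of the
   product type is the Euclidean inner product of R^N. *)

type_synonym 'n field = "real^3 \<Rightarrow> real \<Rightarrow> 'n"
type_synonym ('i, 'n) signal = "'i \<Rightarrow> real \<Rightarrow> 'n"

(* Elements of L2 are represented by functions that are Borel measurable on the set (every L2 class
   has such a representative); values off the set are irrelevant. *)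

definition L2 :: "'a::euclidean_space set \<Rightarrow> ('a \<Rightarrow> 'b::euclidean_space) set" where
  "L2 S = {f. set_borel_measurable lborel S f \<and> set_integrable lborel S (\<lambda>x. (norm (f x))\<^sup>2)}"

definition signals :: "real \<Rightarrow> real \<Rightarrow> ('i::finite, 'n::euclidean_space) signal set" where
  "signals a b = {r. \<forall>i. r i \<in> L2 {a..b}}"

definition signal_inner ::
    "real \<Rightarrow> real \<Rightarrow> ('i::finite, 'n::euclidean_space) signal \<Rightarrow> ('i, 'n) signal \<Rightarrow> real" where
  "signal_inner a b r r' = (\<Sum>i\<in>UNIV. (LINT t:{a..b}|lborel. r i t \<bullet> r' i t))"

definition signal_eq ::
    "real \<Rightarrow> real \<Rightarrow> ('i::finite, 'n::euclidean_space) signal \<Rightarrow> ('i, 'n) signal \<Rightarrow> bool" where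
  "signal_eq a b r r' \<longleftrightarrow> (\<forall>i. AE t in lborel. t \<in> {a..b} \<longrightarrow> r i t = r' i t)"

definition is_adjoint ::
    "real \<Rightarrow> real \<Rightarrow> (('k::finite, 'n::euclidean_space) signal \<Rightarrow> ('j::finite, 'n) signal)
      \<Rightarrow> (('j, 'n) signal \<Rightarrow> ('k, 'n) signal) \<Rightarrow> bool" where
  "is_adjoint a b A C \<longleftrightarrow>
     (\<forall>r\<in>signals a b. A r \<in> signals a b) \<and>
     (\<forall>s\<in>signals a b. C s \<in> signals a b) \<and>
     (\<forall>r\<in>signals a b. \<forall>s\<in>signals a b. signal_inner a b (A r) s = signal_inner a b r (C s))"

(* A* = C, as operators on L2 classes: C is an adjoint of A and every adjoint of A agrees with C
   up to null sets. *)

definition adjoint_equals ::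
    "real \<Rightarrow> real \<Rightarrow> (('k::finite, 'n::euclidean_space) signal \<Rightarrow> ('j::finite, 'n) signal)
      \<Rightarrow> (('j, 'n) signal \<Rightarrow> ('k, 'n) signal) \<Rightarrow> bool" where
  "adjoint_equals a b A C \<longleftrightarrow>
     is_adjoint a b A C \<and>
     (\<forall>C'. is_adjoint a b A C' \<longrightarrow> (\<forall>s\<in>signals a b. signal_eq a b (C' s) (C s)))"

definition material_tensor ::
    "(real^3) set \<Rightarrow> (real^3 \<Rightarrow> 'n::euclidean_space \<Rightarrow> 'n) \<Rightarrow> bool" where
  "material_tensor \<Omega> \<Gamma> \<longleftrightarrow>
     (\<forall>\<xi>. set_borel_measurable lborel \<Omega> (\<lambda>x. \<Gamma> x \<xi>)) \<and>
     (\<forall>x\<in>\<Omega>. linear (\<Gamma> x)) \<and>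
     (\<forall>x\<in>\<Omega>. \<forall>\<xi> \<eta>. \<Gamma> x \<xi> \<bullet> \<eta> = \<xi> \<bullet> \<Gamma> x \<eta>) \<and>
     (\<exists>C. \<forall>x\<in>\<Omega>. \<forall>\<xi>. norm (\<Gamma> x \<xi>) \<le> C * norm \<xi>) \<and>
     (\<exists>c>0. \<forall>x\<in>\<Omega>. \<forall>\<xi>. c * (norm \<xi>)\<^sup>2 \<le> \<Gamma> x \<xi> \<bullet> \<xi>)"

definition field_space ::
    "(real^3) set \<Rightarrow> (real^3 \<Rightarrow> 'n::euclidean_space \<Rightarrow> 'n) \<Rightarrow> real \<Rightarrow> real \<Rightarrow> 'n field set" where
  "field_space \<Omega> \<Gamma> a b =
     {u. (\<lambda>(x, t). u x t) \<in> L2 (\<Omega> \<times> {a..b}) \<and>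
         (\<forall>x\<in>frontier \<Omega>. \<forall>t\<in>{a..b}. u x t = 0) \<and>
         set_integrable lborel (\<Omega> \<times> {a..b}) (\<lambda>(x, t). \<Gamma> x (u x t) \<bullet> u x t)}"

definition partial :: "3 \<Rightarrow> (real^3 \<Rightarrow> 'a::real_normed_vector) \<Rightarrow> real^3 \<Rightarrow> 'a" where
  "partial i f x = frechet_derivative f (at x) (axis i 1)"

definition grad :: "(real^3 \<Rightarrow> real) \<Rightarrow> real^3 \<Rightarrow> real^3" where
  "grad f x = (\<chi> i. partial i f x)"

definition divergence :: "(real^3 \<Rightarrow> real^3) \<Rightarrow> real^3 \<Rightarrow> real" where
  "divergence w x = (\<Sum>i\<in>UNIV. partial i w x $ i)"

definition curl :: "(real^3 \<Rightarrow> real^3) \<Rightarrow> real^3 \<Rightarrow> real^3" where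
  "curl w x = vector
     [partial 2 w x $ 3 - partial 3 w x $ 2,
      partial 3 w x $ 1 - partial 1 w x $ 3,
      partial 1 w x $ 2 - partial 2 w x $ 1]"

(* f is absolutely continuous on [a,b] with a.e. derivative f'. Since signals are merely L2 in time,
   solutions cannot be expected to be differentiable in t at every t. *)

definition has_time_derivative ::
    "real \<Rightarrow> real \<Rightarrow> (real \<Rightarrow> 'n::euclidean_space) \<Rightarrow> (real \<Rightarrow> 'n) \<Rightarrow> bool" where
  "has_time_derivative a b f f' \<longleftrightarrow>
     set_integrable lborel {a..b} f' \<and>
     (\<forall>t\<in>{a..b}. f t = f a + (LINT \<tau>:{a..t}|lborel. f' \<tau>))"

(* The regularity under which integration by parts is legitimate: classical first order derivatives
   in space, continuity up to the boundary, absolute continuity in time, and u and its first order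
   derivatives square integrable in space-time. Here u' is the time derivative of u. *)

definition regular_field ::
    "(real^3) set \<Rightarrow> real \<Rightarrow> real \<Rightarrow> 'n::euclidean_space field \<Rightarrow> 'n field \<Rightarrow> bool" where
  "regular_field \<Omega> a b u u' \<longleftrightarrow>
     (\<forall>x\<in>\<Omega>. has_time_derivative a b (u x) (u' x)) \<and>
     (\<forall>t\<in>{a..b}. continuous_on (closure \<Omega>) (\<lambda>x. u x t)) \<and>
     (\<forall>t\<in>{a..b}. \<forall>x\<in>\<Omega>. (\<lambda>y. u y t) differentiable (at x)) \<and>
     (\<lambda>(x, t). u' x t) \<in> L2 (\<Omega> \<times> {a..b}) \<and>
     (\<forall>i. (\<lambda>(x, t). partial i (\<lambda>y. u y t) x) \<in> L2 (\<Omega> \<times> {a..b}))"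

definition acoustic_tensor ::
    "(real^3 \<Rightarrow> real) \<Rightarrow> (real^3 \<Rightarrow> real) \<Rightarrow> real^3 \<Rightarrow> (real^3) \<times> real \<Rightarrow> (real^3) \<times> real" where
  "acoustic_tensor \<rho> \<kappa> x = (\<lambda>(v, p). (\<rho> x *\<^sub>R v, \<kappa> x * p))"

definition em_tensor ::
    "(real^3 \<Rightarrow> real^3^3) \<Rightarrow> (real^3 \<Rightarrow> real^3^3) \<Rightarrow> real^3 \<Rightarrow> (real^3) \<times> (real^3) \<Rightarrow> (real^3) \<times> (real^3)" where
  "em_tensor \<epsilon> \<mu> x = (\<lambda>(E, H). (\<epsilon> x *v E, \<mu> x *v H))"

definition conductivity :: "(real^3) set \<Rightarrow> (real^3 \<Rightarrow> real^3^3) \<Rightarrow> bool" where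
  "conductivity \<Omega> \<sigma> \<longleftrightarrow>
     set_borel_measurable lborel \<Omega> \<sigma> \<and>
     (\<forall>x\<in>\<Omega>. transpose (\<sigma> x) = \<sigma> x \<and> (\<forall>\<xi>. 0 \<le> \<xi> \<bullet> (\<sigma> x *v \<xi>)))"

definition acoustic_solves ::
    "(real^3) set \<Rightarrow> (real^3 \<Rightarrow> real) \<Rightarrow> (real^3 \<Rightarrow> real) \<Rightarrow> real \<Rightarrow> real
      \<Rightarrow> ((real^3) \<times> real) field \<Rightarrow> ((real^3) \<times> real) field \<Rightarrow> bool" where
  "acoustic_solves \<Omega> \<rho> \<kappa> a b q u \<longleftrightarrow>
     u \<in> field_space \<Omega> (acoustic_tensor \<rho> \<kappa>) a b \<and>
     (\<exists>u'. regular_field \<Omega> a b u u' \<and>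
       (\<forall>x\<in>\<Omega>. u x a = 0) \<and>
       (AE (x, t) in lborel. x \<in> \<Omega> \<and> t \<in> {a..b} \<longrightarrow>
          \<rho> x *\<^sub>R fst (u' x t) + grad (\<lambda>y. snd (u y t)) x = fst (q x t) \<and>
          \<kappa> x * snd (u' x t) + divergence (\<lambda>y. fst (u y t)) x = snd (q x t)))"

definition em_solves ::
    "(real^3) set \<Rightarrow> (real^3 \<Rightarrow> real^3^3) \<Rightarrow> (real^3 \<Rightarrow> real^3^3) \<Rightarrow> (real^3 \<Rightarrow> real^3^3) \<Rightarrow> real \<Rightarrow> real
      \<Rightarrow> ((real^3) \<times> (real^3)) field \<Rightarrow> ((real^3) \<times> (real^3)) field \<Rightarrow> bool" where
  "em_solves \<Omega> \<epsilon> \<mu> \<sigma> a b q u \<longleftrightarrow>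
     u \<in> field_space \<Omega> (em_tensor \<epsilon> \<mu>) a b \<and>
     (\<exists>u'. regular_field \<Omega> a b u u' \<and>
       (\<forall>x\<in>\<Omega>. u x a = 0) \<and>
       (AE (x, t) in lborel. x \<in> \<Omega> \<and> t \<in> {a..b} \<longrightarrow>
          \<epsilon> x *v fst (u' x t) - curl (\<lambda>y. snd (u y t)) x + \<sigma> x *v fst (u x t) = fst (q x t) \<and>
          \<mu> x *v snd (u' x t) + curl (\<lambda>y. fst (u y t)) x = snd (q x t)))"

(* "F is well defined" on a class of sources; F q is then a solution for the source q. *)

definition solvable_on :: "('n field \<Rightarrow> 'n field \<Rightarrow> bool) \<Rightarrow> 'n field set \<Rightarrow> bool" where
  "solvable_on solves S \<longleftrightarrow> (\<forall>q\<in>S. \<exists>u. solves q u)"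

definition solution_operator :: "('n field \<Rightarrow> 'n field \<Rightarrow> bool) \<Rightarrow> 'n field \<Rightarrow> 'n field" where
  "solution_operator solves q = (SOME u. solves q u)"

definition source ::
    "('i::finite \<Rightarrow> real^3 \<Rightarrow> real) \<Rightarrow> ('i, 'n::euclidean_space) signal \<Rightarrow> 'n field" where
  "source g r x t = (\<Sum>i\<in>UNIV. g i x *\<^sub>R r i t)"

definition measurement ::
    "(real^3) set \<Rightarrow> ('i \<Rightarrow> real^3 \<Rightarrow> real) \<Rightarrow> 'n::euclidean_space field \<Rightarrow> ('i, 'n) signal" where
  "measurement \<Omega> g u i t = (LINT x:\<Omega>|lborel. g i x *\<^sub>R u x t)"

(* Signals are emitted through g and received through h. With \<gamma>h for the users and \<gamma> for the base
   antennas, A has g = \<gamma>, h = \<gamma>h and B has g = \<gamma>h, h = \<gamma>. *)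

definition communication ::
    "(real^3) set \<Rightarrow> ('n field \<Rightarrow> 'n field) \<Rightarrow> ('i::finite \<Rightarrow> real^3 \<Rightarrow> real) \<Rightarrow> ('l::finite \<Rightarrow> real^3 \<Rightarrow> real)
      \<Rightarrow> ('i, 'n::euclidean_space) signal \<Rightarrow> ('l, 'n) signal" where
  "communication \<Omega> F g h r = measurement \<Omega> h (F (source g r))"

(* Both mirrors change the sign of the first component (velocity, respectively electric field). *)

definition time_reversal ::
    "real \<Rightarrow> ('i, 'm::euclidean_space \<times> 'l::euclidean_space) signal \<Rightarrow> ('i, 'm \<times> 'l) signal" where
  "time_reversal T r i t = (- fst (r i (2 * T - t)), snd (r i (2 * T - t)))"

definition antenna_profiles ::
    "(real^3) set \<Rightarrow> ('j::finite \<Rightarrow> real^3) \<Rightarrow> ('k::finite \<Rightarrow> real^3)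
      \<Rightarrow> ('j \<Rightarrow> real^3 \<Rightarrow> real) \<Rightarrow> ('k \<Rightarrow> real^3 \<Rightarrow> real) \<Rightarrow> bool" where
  "antenna_profiles \<Omega> dh d \<gamma>h \<gamma> \<longleftrightarrow>
     (\<forall>j. \<gamma>h j \<in> L2 \<Omega>) \<and> (\<forall>k. \<gamma> k \<in> L2 \<Omega>) \<and>
     (\<exists>V :: 'j + 'k \<Rightarrow> (real^3) set.
        disjoint_family V \<and>
        (\<forall>i. open (V i) \<and> V i \<subseteq> \<Omega> \<and> case_sum dh d i \<in> V i \<and>
             closure {x. case_sum \<gamma>h \<gamma> i x \<noteq> 0} \<subseteq> V i))"

end

(* Both systems have the symmetric hyperbolic form G u_t + sum_i A_i u_{x_i} + S u = q. Let J change
   the sign of the first component. Since J commutes with G and S and anticommutes with each A_i, a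
   solution w on [T,2T] with source p gives z(x,t) = J w(x,2T-t), which solves the adjoint system
   -G z_t - sum_i A_i z_{x_i} + S z = J p(x,2T-t) backwards from z(T) = 0. Then <q,z> - <u,J p(2T-.)>
   is the integral of d/dt <G u,z> plus that of sum_i d/dx_i <A_i u,z>. The first vanishes by the
   initial and final conditions, the second because the fields vanish on the boundary, and reading
   <q,z> and <u,J p(2T-.)> as signal inner products gives the adjoint identity. *)

theory Submission
  imports Defs
begin

section \<open>Integrating a derivative over an open set\<close>

text \<open>The boundary term is the delicate point. \<open>\<Omega>\<close> is an arbitrary open
  set, so there is no normal field and no divergence theorem, and the extension by zero of a product
  of two fields is continuous but need not be differentiable on the boundary. A line may moreover
  cross \<open>\<Omega>\<close> in infinitely many intervals. The remedy is to compose with a C1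
  function that vanishes near 0 and has slope at most 1: near a boundary point the extension is
  small, so the composite is identically 0 there, the fundamental theorem of calculus applies along
  the whole line, and dominated convergence removes the cut-off. In time the fields are only
  absolutely continuous, and Fubini on a triangle replaces the product rule. The equations hold
  almost everywhere in space-time, whereas the integrations run along single slices; square
  integrability of all terms lets Fubini pass between the two. The identity obtained holds for every
  pair of solutions, hence for whichever ones the solution operators choose.\<close>

definition soft_threshold :: "real \<Rightarrow> real \<Rightarrow> real" where
  "soft_threshold e y = sgn y * (max 0 (\<bar>y\<bar> - e))\<^sup>2 / \<bar>y\<bar>"

text \<open>The maximum replaces a case distinction: for |y| \<le> e the fraction is 1 and the slope
  0. For e > 0 the denominator never vanishes, so continuity is immediate.\<close>

definition soft_threshold' :: "real \<Rightarrow> real \<Rightarrow> real" where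
  "soft_threshold' e y = 1 - e\<^sup>2 / (max e \<bar>y\<bar>)\<^sup>2"

text \<open>For y > e the function is y - 2e + e^2/y, with slope 1 - e^2/y^2. The square lets this
  slope fall to 0 at y = e, where it meets the zero branch; the division by |y| keeps it below
  1.\<close>

lemma has_real_derivative_soft_threshold:
  assumes e: "0 < e"
  shows "(soft_threshold e has_real_derivative soft_threshold' e y) (at y)"
proof -
  consider "\<bar>y\<bar> < e" | "y > e" | "y < - e" | "\<bar>y\<bar> = e" by linarith
  then show ?thesis
  proof cases
    case 1
    have "((\<lambda>_. 0) has_real_derivative 0) (at y)" by simp
    moreover have "open {-e<..<e}" "y \<in> {-e<..<e}" using 1 by auto
    ultimately have "(soft_threshold e has_real_derivative 0) (at y)"
      by (rule has_field_derivative_transform_within_open) (auto simp: soft_threshold_def max_def)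
    then show ?thesis using 1 e by (simp add: soft_threshold'_def max_def)
  next
    case 2
    have "((\<lambda>z. (z - e)\<^sup>2 / z) has_real_derivative 1 - e\<^sup>2 / y\<^sup>2) (at y)"
      using 2 e by (auto intro!: derivative_eq_intros simp: field_simps power2_eq_square)
    moreover have "open {e<..}" "y \<in> {e<..}" using 2 by auto
    ultimately have "(soft_threshold e has_real_derivative 1 - e\<^sup>2 / y\<^sup>2) (at y)"
      by (rule has_field_derivative_transform_within_open)
         (use e in \<open>auto simp: soft_threshold_def max_def\<close>)
    then show ?thesis using 2 e by (simp add: soft_threshold'_def max_def)
  next
    case 3
    have "((\<lambda>z. (z + e)\<^sup>2 / z) has_real_derivative 1 - e\<^sup>2 / y\<^sup>2) (at y)"
      using 3 e by (auto intro!: derivative_eq_intros simp: field_simps power2_eq_square)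
    moreover have "open {..<-e}" "y \<in> {..<-e}" using 3 by auto
    ultimately have "(soft_threshold e has_real_derivative 1 - e\<^sup>2 / y\<^sup>2) (at y)"
      by (rule has_field_derivative_transform_within_open)
         (use e in \<open>auto simp: soft_threshold_def max_def power2_eq_square field_simps\<close>)
    then show ?thesis using 3 e by (simp add: soft_threshold'_def max_def)
  next
    case 4
    \<comment> \<open>At the junction the increment is quadratic in h, because | |y + h| - e | \<le>
      |h|; hence the difference quotient tends to 0.\<close>
    have bound: "\<bar>soft_threshold e (y + h)\<bar> \<le> h\<^sup>2 / e" for h
    proof (cases "\<bar>y + h\<bar> \<le> e")
      case True
      then show ?thesis using e by (simp add: soft_threshold_def max_def)
    next
      case False
      have "(\<bar>y + h\<bar> - e)\<^sup>2 \<le> h\<^sup>2"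
        unfolding abs_le_square_iff[symmetric] using False 4 by linarith
      then have "(\<bar>y + h\<bar> - e)\<^sup>2 / \<bar>y + h\<bar> \<le> h\<^sup>2 / e"
        using False e by (intro frac_le) auto
      then show ?thesis using False e
        by (simp add: soft_threshold_def max_def abs_mult abs_sgn_eq)
    qed
    have 0: "soft_threshold e y = 0" using 4 by (simp add: soft_threshold_def)
    have "((\<lambda>h. (soft_threshold e (y + h) - soft_threshold e y) / h) \<longlongrightarrow> 0) (at 0)"
    proof (rule Lim_null_comparison)
      show "\<forall>\<^sub>F h in at 0. norm ((soft_threshold e (y + h) - soft_threshold e y) / h) \<le> \<bar>h\<bar> / e"
      proof (rule eventually_at_filter[THEN iffD2], intro always_eventually allI impI)
        fix h :: real assume "h \<noteq> 0"
        then show "norm ((soft_threshold e (y + h) - soft_threshold e y) / h) \<le> \<bar>h\<bar> / e"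
          using bound[of h] e 0 by (simp add: field_simps power2_eq_square abs_mult_self_eq)
      qed
      have "((\<lambda>h. \<bar>h\<bar> / e) \<longlongrightarrow> \<bar>0\<bar> / e) (at 0)" using e by (intro tendsto_intros) auto
      then show "((\<lambda>h. \<bar>h\<bar> / e) \<longlongrightarrow> 0) (at 0)" by simp
    qed
    then have "(soft_threshold e has_real_derivative 0) (at y)" by (simp add: DERIV_def)
    then show ?thesis using 4 e by (simp add: soft_threshold'_def max_def)
  qed
qed

lemma abs_soft_threshold'_le: "0 < e \<Longrightarrow> \<bar>soft_threshold' e y\<bar> \<le> 1"
proof -
  assume e: "0 < e"
  then have "0 < (max e \<bar>y\<bar>)\<^sup>2" "e\<^sup>2 \<le> (max e \<bar>y\<bar>)\<^sup>2"
    by (auto intro!: power_mono)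
  then have "0 \<le> e\<^sup>2 / (max e \<bar>y\<bar>)\<^sup>2" "e\<^sup>2 / (max e \<bar>y\<bar>)\<^sup>2 \<le> 1"
    by simp_all
  then show ?thesis unfolding soft_threshold'_def by linarith
qed

lemma continuous_on_soft_threshold':
  assumes "0 < e" shows "continuous_on UNIV (soft_threshold' e)"
  unfolding soft_threshold'_def using assms by (intro continuous_intros) (auto simp: max_def)

lemma tendsto_soft_threshold: "((\<lambda>e. soft_threshold e y) \<longlongrightarrow> y) (at_right 0)"
proof -
  have "((\<lambda>e. soft_threshold e y) \<longlongrightarrow> sgn y * (max 0 (\<bar>y\<bar> - 0))\<^sup>2 / \<bar>y\<bar>) (at_right 0)"
    unfolding soft_threshold_def divide_inverse by (intro tendsto_intros)
  also have "sgn y * (max 0 (\<bar>y\<bar> - 0))\<^sup>2 / \<bar>y\<bar> = y"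
    by (simp add: sgn_real_def power2_eq_square)
  finally show ?thesis .
qed

lemma tendsto_soft_threshold':
  assumes "y \<noteq> 0"
  shows "((\<lambda>e. soft_threshold' e y) \<longlongrightarrow> 1) (at_right 0)"
proof -
  have "((\<lambda>e. soft_threshold' e y) \<longlongrightarrow> 1 - 0\<^sup>2 / (max 0 \<bar>y\<bar>)\<^sup>2) (at_right 0)"
    unfolding soft_threshold'_def using assms by (intro tendsto_intros) (auto simp: max_def)
  then show ?thesis by simp
qed

text \<open>A zero with nonzero derivative is isolated, since nearby difference quotients stay away
  from 0, and a set of isolated points of the line is countable. For the zero extension these are
  the only points where the derivatives of the cut-off functions fail to converge to the derivative
  itself: the cut-off has slope 0 at the value 0 for every \<open>e\<close>.\<close>

lemma countable_zeros_nonzero_derivative: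
  fixes g :: "real \<Rightarrow> real"
  assumes der: "\<And>s. s \<in> Z \<Longrightarrow> \<exists>D. D \<noteq> 0 \<and> (g has_real_derivative D) (at s)"
    and zero: "\<And>s. s \<in> Z \<Longrightarrow> g s = 0"
  shows "countable Z"
proof -
  have "\<exists>T. open T \<and> s \<in> T \<and> (\<forall>t\<in>T. g t = 0 \<longrightarrow> t = s)" if "s \<in> Z" for s
  proof -
    obtain D where D: "D \<noteq> 0" "(g has_real_derivative D) (at s)" using der[OF \<open>s \<in> Z\<close>] by blast
    have "((\<lambda>t. (g t - g s) / (t - s)) \<longlongrightarrow> D) (at s)"
      using D(2) by (simp add: has_field_derivative_iff)
    then have "\<forall>\<^sub>F t in at s. (g t - g s) / (t - s) \<noteq> 0"
      using D(1) by (rule tendsto_imp_eventually_ne)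
    then obtain T where "open T" "s \<in> T" "\<forall>t\<in>T. t \<noteq> s \<longrightarrow> (g t - g s) / (t - s) \<noteq> 0"
      unfolding eventually_at_topological by blast
    then have "\<forall>t\<in>T. g t = 0 \<longrightarrow> t = s" using zero[OF that] by auto
    then show ?thesis using \<open>open T\<close> \<open>s \<in> T\<close> by blast
  qed
  then have "\<forall>s\<in>Z. \<exists>T. open T \<and> s \<in> T \<and> (\<forall>t\<in>T. g t = 0 \<longrightarrow> t = s)" by blast
  from bchoice[OF this] obtain N
    where "\<forall>s\<in>Z. open (N s) \<and> s \<in> N s \<and> (\<forall>t\<in>N s. g t = 0 \<longrightarrow> t = s)" ..
  then have N: "\<And>s. s \<in> Z \<Longrightarrow> open (N s)" "\<And>s. s \<in> Z \<Longrightarrow> s \<in> N s"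
    "\<And>s t. s \<in> Z \<Longrightarrow> t \<in> N s \<Longrightarrow> g t = 0 \<Longrightarrow> t = s" by blast+
  define D where "D = (\<Union>s\<in>Z. N s)"
  have "open D" unfolding D_def by (intro open_UN ballI N(1))
  moreover have "Z sparse_in D"
  \<comment> \<open>A point of \<open>D\<close> need not lie in \<open>Z\<close>. If it differs from
    the centre \<open>s\<close> of its neighbourhood, removing \<open>s\<close> leaves an open set
    without points of \<open>Z\<close>.\<close>
  proof (subst sparse_in_eventually_iff[OF \<open>open D\<close>], intro ballI)
    fix y assume "y \<in> D"
    then obtain s where s: "s \<in> Z" "y \<in> N s" by (auto simp: D_def)
    have "open (if y = s then N s else N s - {s})"
      using N(1)[OF s(1)] by (simp add: open_delete)
    moreover have "y \<in> (if y = s then N s else N s - {s})" using s(2) by auto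
    moreover have "x \<notin> Z" if "x \<in> (if y = s then N s else N s - {s})" "x \<noteq> y" for x
      using that N(3)[OF s(1), of x] zero[of x] by (auto split: if_splits)
    ultimately show "\<forall>\<^sub>F y in at y. y \<notin> Z"
      unfolding eventually_at_topological by blast
  qed
  ultimately have "countable (D \<inter> Z)" by (rule sparse_imp_countable)
  moreover have "D \<inter> Z = Z" unfolding D_def using N(2) by blast
  ultimately show ?thesis by simp
qed

text \<open>No regularity of \<open>U\<close> is needed: composing \<open>g\<close> with a function that vanishes near \<open>0\<close> makes
  it differentiable across the boundary of \<open>U\<close>.\<close>

lemma integral_derivative_zero_extension:
  fixes g g' :: "real \<Rightarrow> real"
  assumes ab: "a \<le> b" and g: "continuous_on UNIV g" and U: "open U"
    and g0: "\<And>s. s \<notin> U \<Longrightarrow> g s = 0"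
    and g': "\<And>s. s \<in> U \<Longrightarrow> (g has_real_derivative g' s) (at s)"
    and g'0: "\<And>s. s \<notin> U \<Longrightarrow> g' s = 0"
    and int: "set_integrable lborel {a..b} g'"
  shows "(LINT s:{a..b}|lborel. g' s) = g b - g a"
proof -
  define e :: "nat \<Rightarrow> real" where "e n = inverse (real (Suc n))" for n
  have e0: "e n > 0" for n by (simp add: e_def)
  have e_lim: "filterlim e (at_right 0) sequentially"
    unfolding filterlim_at using e0 LIMSEQ_inverse_real_of_nat
    by (simp add: e_def[abs_def] always_eventually)
  have gm[measurable]: "g \<in> borel_measurable borel"
    using g by (rule borel_measurable_continuous_onI)
  have tm[measurable]: "soft_threshold' (e n) \<in> borel_measurable borel" for n
    using continuous_on_soft_threshold'[OF e0] by (rule borel_measurable_continuous_onI)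
  let ?I = "indicator {a..b} :: real \<Rightarrow> real"
  let ?f = "\<lambda>n s. ?I s *\<^sub>R (soft_threshold' (e n) (g s) * g' s)"
  have Im[measurable]: "(\<lambda>s. ?I s *\<^sub>R g' s) \<in> borel_measurable lborel"
    using int by (auto simp: set_integrable_def)
  have feq: "?f n = (\<lambda>s. soft_threshold' (e n) (g s) * (?I s *\<^sub>R g' s))" for n
    by (auto simp: fun_eq_iff indicator_def)
  have fm: "?f n \<in> borel_measurable lborel" for n
    unfolding feq by measurable
  have bound: "norm (?f n s) \<le> norm (?I s *\<^sub>R g' s)" for n s
    using abs_soft_threshold'_le[OF e0, of n "g s"]
    by (auto simp: indicator_def abs_mult intro: mult_left_le_one_le)
  have si: "set_integrable lborel {a..b} (\<lambda>s. soft_threshold' (e n) (g s) * g' s)" for n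
    unfolding set_integrable_def
    by (rule Bochner_Integration.integrable_bound[OF int[unfolded set_integrable_def] fm])
       (use bound in auto)
  have der: "((\<lambda>s. soft_threshold (e n) (g s)) has_real_derivative
      soft_threshold' (e n) (g s) * g' s) (at s)" for n s
  proof (cases "s \<in> U")
    case True
    show ?thesis
      using DERIV_chain2[OF has_real_derivative_soft_threshold[OF e0] g'[OF True]] .
  next
    case False
    \<comment> \<open>Continuity and the value 0 at \<open>s\<close> give |g| < e on a full
      neighbourhood. It may meet \<open>U\<close>, but the composite is 0 on all of it.\<close>
    let ?V = "g -` {- e n<..<e n}"
    have "open ?V" using g by (intro open_vimage) auto
    moreover have "s \<in> ?V" using g0[OF False] e0[of n] by auto
    moreover have "soft_threshold (e n) (g t) = 0" if "t \<in> ?V" for t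
    proof -
      have "\<bar>g t\<bar> < e n" using that by (simp add: abs_less_iff)
      then show ?thesis by (simp add: soft_threshold_def)
    qed
    ultimately have "((\<lambda>s. soft_threshold (e n) (g s)) has_real_derivative 0) (at s)"
      using has_field_derivative_transform_within_open[of "\<lambda>_. 0" 0 s ?V] by simp
    then show ?thesis using g'0[OF False] by simp
  qed
  have eq: "integral\<^sup>L lborel (?f n) = soft_threshold (e n) (g b) - soft_threshold (e n) (g a)" for n
  proof -
    \<comment> \<open>The gauge integral version of the fundamental theorem asks for a derivative at
      every point and not for its continuity; \<open>si\<close> identifies the result with a
      Lebesgue integral.\<close>
    have "((\<lambda>s. soft_threshold' (e n) (g s) * g' s) has_integral
        soft_threshold (e n) (g b) - soft_threshold (e n) (g a)) {a..b}"
      using ab der[THEN has_field_derivative_at_within]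
      by (intro fundamental_theorem_of_calculus)
         (auto simp: has_real_derivative_iff_has_vector_derivative)
    then show ?thesis
      using set_borel_integral_eq_integral(2)[OF si[of n]] integral_unique
      by (metis set_lebesgue_integral_def)
  qed
  define Z where "Z = {s \<in> U. g s = 0 \<and> g' s \<noteq> 0}"
  have "countable Z"
    by (rule countable_zeros_nonzero_derivative[of Z g]) (use g' in \<open>auto simp: Z_def\<close>)
  then have Z: "AE s in lborel. s \<notin> Z"
    by (intro AE_not_in countable_imp_null_set_lborel)
  have "(\<lambda>n. integral\<^sup>L lborel (?f n)) \<longlonglongrightarrow> (LINT s|lborel. ?I s *\<^sub>R g' s)"
  proof (rule integral_dominated_convergence[where w = "\<lambda>s. norm (?I s *\<^sub>R g' s)"])
    show "AE s in lborel. (\<lambda>n. ?f n s) \<longlonglongrightarrow> ?I s *\<^sub>R g' s"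
      using Z
    proof eventually_elim
      case (elim s)
      show ?case
      proof (cases "g' s = 0")
        case False
        then have "g s \<noteq> 0" using elim g'0[of s] by (auto simp: Z_def)
        then have "(\<lambda>n. soft_threshold' (e n) (g s)) \<longlonglongrightarrow> 1"
          using filterlim_compose[OF tendsto_soft_threshold' e_lim] by blast
        then have "(\<lambda>n. ?f n s) \<longlonglongrightarrow> ?I s *\<^sub>R (1 * g' s)" by (intro tendsto_intros)
        then show ?thesis by simp
      qed simp
    qed
    show "integrable lborel (\<lambda>s. norm (?I s *\<^sub>R g' s))"
      using int unfolding set_integrable_def by (rule integrable_norm)
  qed (use fm Im bound in auto)
  moreover have "(\<lambda>n. integral\<^sup>L lborel (?f n)) \<longlonglongrightarrow> g b - g a"
    unfolding eq by (intro tendsto_diff filterlim_compose[OF tendsto_soft_threshold e_lim])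
  ultimately show ?thesis
    unfolding set_lebesgue_integral_def using LIMSEQ_unique by blast
qed

section \<open>Integrals of spatial derivatives over an open set\<close>

lemma
  fixes f :: "'a::euclidean_space \<Rightarrow> 'b::{banach, second_countable_topology}"
  assumes f: "integrable lborel f"
  shows integrable_translate: "integrable lborel (\<lambda>x. f (c + x))"
    and integral_translate: "(LINT x|lborel. f (c + x)) = (LINT x|lborel. f x)"
proof -
  have "integrable (distr lborel borel ((+) c)) f" using f by (simp add: lborel_distr_plus)
  then show "integrable lborel (\<lambda>x. f (c + x))" by (rule integrable_distr[rotated]) simp
  have "integral\<^sup>L lborel f = integral\<^sup>L (distr lborel borel ((+) c)) f"
    by (simp add: lborel_distr_plus)
  also have "\<dots> = (LINT x|lborel. f (c + x))"
    using borel_measurable_integrable[OF f] by (intro integral_distr) auto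
  finally show "(LINT x|lborel. f (c + x)) = (LINT x|lborel. f x)" ..
qed

text \<open>With \<open>g\<close> and \<open>g'\<close> extended by zero, \<open>g (x + e) - g x\<close> is the integral of
  \<open>g' (x + s e)\<close> over \<open>0 \<le> s \<le> 1\<close>. Integrating over \<open>x\<close>, the left-hand side
  vanishes by translation invariance and the right-hand side is the integral in question.\<close>

lemma integral_directional_derivative_eq_0:
  fixes g :: "'a::euclidean_space \<Rightarrow> real"
  assumes \<Omega>: "open \<Omega>" and g: "continuous_on (closure \<Omega>) g"
    and g0: "\<And>x. x \<in> frontier \<Omega> \<Longrightarrow> g x = 0"
    and der: "\<And>x. x \<in> \<Omega> \<Longrightarrow> (g has_derivative g' x) (at x)"
    and int: "set_integrable lborel \<Omega> g" and int': "set_integrable lborel \<Omega> (\<lambda>x. g' x e)"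
  shows "(LINT x:\<Omega>|lborel. g' x e) = 0"
proof -
  define h where "h x = indicator \<Omega> x *\<^sub>R g x" for x
  define G where "G x = indicator \<Omega> x *\<^sub>R g' x e" for x
  have h_int: "integrable lborel h" and G_int: "integrable lborel G"
    using int int' by (auto simp: set_integrable_def h_def[abs_def] G_def[abs_def])
  have [measurable]: "G \<in> borel_measurable borel"
    using borel_measurable_integrable[OF G_int] by simp
  \<comment> \<open>The boundary values 0 glue the two closed pieces, the closure and the complement
    of \<open>\<Omega>\<close>.\<close>
  have h_cont: "continuous_on UNIV h"
  proof -
    have eq: "h = (\<lambda>x. if x \<in> closure \<Omega> then g x else 0)"
      using g0 by (auto simp: h_def fun_eq_iff indicator_def frontier_def interior_open[OF \<Omega>]
          dest: subsetD[OF closure_subset])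
    have "continuous_on (closure \<Omega> \<union> - \<Omega>) (\<lambda>x. if x \<in> closure \<Omega> then g x else 0)"
      using \<Omega> g g0 by (intro continuous_on_cases)
        (auto simp: frontier_def interior_open closed_Compl)
    moreover have "closure \<Omega> \<union> - \<Omega> = UNIV" using closure_subset by blast
    ultimately show ?thesis unfolding eq by simp
  qed
  \<comment> \<open>Integrability of \<open>G\<close> along the segment is a premise here because
    Fubini for \<open>k\<close> provides it for almost every \<open>x\<close> only.\<close>
  have line: "(LINT s:{0..1}|lborel. G (s *\<^sub>R e + x)) = h (e + x) - h x"
    if "set_integrable lborel {0..1} (\<lambda>s. G (s *\<^sub>R e + x))" for x
  proof -
    define U where "U = (\<lambda>s. s *\<^sub>R e + x) -` \<Omega>"
    have "continuous_on UNIV (\<lambda>s. h (s *\<^sub>R e + x))"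
      by (rule continuous_on_compose2[OF h_cont]) (auto intro!: continuous_intros)
    moreover have "open U"
      unfolding U_def by (rule open_vimage[OF \<Omega>]) (auto intro!: continuous_intros)
    moreover have "((\<lambda>s. h (s *\<^sub>R e + x)) has_real_derivative G (s *\<^sub>R e + x)) (at s)"
      if "s \<in> U" for s
    proof -
      have s: "s *\<^sub>R e + x \<in> \<Omega>" using that by (simp add: U_def)
      have "(h has_derivative g' (s *\<^sub>R e + x)) (at (s *\<^sub>R e + x))"
        using der[OF s] \<Omega> s by (rule has_derivative_transform_within_open) (simp add: h_def)
      moreover have "((\<lambda>s. s *\<^sub>R e + x) has_derivative (\<lambda>t. t *\<^sub>R e)) (at s)"
        by (auto intro!: derivative_eq_intros)
      ultimately have "((\<lambda>s. h (s *\<^sub>R e + x)) has_derivative (\<lambda>t. g' (s *\<^sub>R e + x) (t *\<^sub>R e))) (at s)"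
        using has_derivative_compose by blast
      moreover have "g' (s *\<^sub>R e + x) (t *\<^sub>R e) = G (s *\<^sub>R e + x) * t" for t
        using linear_scale[OF has_derivative_linear[OF der[OF s]]] s by (simp add: G_def)
      ultimately show ?thesis by (simp add: has_field_derivative_def)
    qed
    ultimately show ?thesis
      using integral_derivative_zero_extension[of 0 1 "\<lambda>s. h (s *\<^sub>R e + x)" U
          "\<lambda>s. G (s *\<^sub>R e + x)"] that
      by (simp add: U_def h_def G_def)
  qed
  define k where "k s x = indicator {0..1::real} s *\<^sub>R G (s *\<^sub>R e + x)" for s x
  \<comment> \<open>By translation invariance the integral of |G(x + s e)| over \<open>x\<close> is
    the same for all \<open>s\<close>, so its integral over the unit interval is finite.\<close>
  have k_int: "integrable (lborel \<Otimes>\<^sub>M lborel) (case_prod k)"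
  proof (rule lborel_pair.Fubini_integrable)
    show "case_prod k \<in> borel_measurable (lborel \<Otimes>\<^sub>M lborel)"
      unfolding k_def[abs_def] by measurable
    have "(\<lambda>s. LINT x|lborel. norm (case_prod k (s, x)))
        = (\<lambda>s. indicator {0..1::real} s *\<^sub>R (LINT x|lborel. norm (G x)))"
      using integral_translate[OF integrable_norm[OF G_int]] by (auto simp: k_def indicator_def)
    then show "integrable lborel (\<lambda>s. LINT x|lborel. norm (case_prod k (s, x)))"
      by (simp del: real_norm_def real_scaleR_def)
    show "AE s in lborel. integrable lborel (\<lambda>x. case_prod k (s, x))"
      using integrable_translate[OF G_int] by (auto simp: k_def)
  qed
  have "(LINT s|lborel. (LINT x|lborel. k s x))
      = (LINT s|lborel. indicator {0..1::real} s *\<^sub>R (LINT x|lborel. G x))"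
    by (simp add: k_def integral_translate[OF G_int])
  also have "\<dots> = (LINT x|lborel. G x)" by (simp add: content_real)
  finally have "(LINT x|lborel. G x) = (LINT x|lborel. (LINT s|lborel. k s x))"
    using lborel_pair.Fubini_integral[OF k_int] by simp
  also have "\<dots> = (LINT x|lborel. h (e + x) - h x)"
  proof (rule integral_cong_AE)
    show "(\<lambda>x. LINT s|lborel. k s x) \<in> borel_measurable lborel"
      using lborel_pair.integrable_snd[OF k_int] by simp
    show "(\<lambda>x. h (e + x) - h x) \<in> borel_measurable lborel"
      using integrable_translate[OF h_int, of e] h_int by auto
    show "AE x in lborel. (LINT s|lborel. k s x) = h (e + x) - h x"
      using lborel_pair.AE_integrable_snd[OF k_int] line
      by (auto simp: k_def set_integrable_def set_lebesgue_integral_def)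
  qed
  also have "\<dots> = 0"
    using integrable_translate[OF h_int, of e] h_int integral_translate[OF h_int, of e] by simp
  finally show ?thesis by (simp add: G_def set_lebesgue_integral_def)
qed

section \<open>Integration by parts in time\<close>

lemma integrable_product_mult:
  fixes f :: "'a::euclidean_space \<Rightarrow> real" and g :: "'b::euclidean_space \<Rightarrow> real"
  assumes f: "integrable lborel f" and g: "integrable lborel g"
  shows "integrable (lborel \<Otimes>\<^sub>M lborel) (\<lambda>(x, y). f x * g y)"
proof (rule lborel_pair.Fubini_integrable)
  have [measurable]: "f \<in> borel_measurable borel" "g \<in> borel_measurable borel"
    using f g by (auto dest!: borel_measurable_integrable)
  show "(\<lambda>(x, y). f x * g y) \<in> borel_measurable (lborel \<Otimes>\<^sub>M lborel)" by measurable
  show "integrable lborel (\<lambda>x. LINT y|lborel. norm (case (x, y) of (x, y) \<Rightarrow> f x * g y))"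
    using f by (simp add: abs_mult)
qed (use g in auto)

text \<open>Both sides are the integral of F(t) . G(\<tau>) over the triangle a \<le> t \<le> \<tau>
  \<le> b. No boundary term appears because the two primitives are based at opposite ends: one
  vanishes at \<open>a\<close>, the other at \<open>b\<close>.\<close>

lemma absolutely_continuous_integral_by_parts:
  fixes F G :: "real \<Rightarrow> 'a::euclidean_space"
  assumes F: "set_integrable lborel {a..b} F" and G: "set_integrable lborel {a..b} G"
  shows "(LINT t:{a..b}|lborel. F t \<bullet> (LINT \<tau>:{t..b}|lborel. G \<tau>))
    = (LINT \<tau>:{a..b}|lborel. (LINT t:{a..\<tau>}|lborel. F t) \<bullet> G \<tau>)"
proof -
  define F0 where "F0 t = indicator {a..b} t *\<^sub>R F t" for t
  define G0 where "G0 t = indicator {a..b} t *\<^sub>R G t" for t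
  have F0: "integrable lborel F0" and G0: "integrable lborel G0"
    using F G by (auto simp: set_integrable_def F0_def[abs_def] G0_def[abs_def])
  have [measurable]: "F0 \<in> borel_measurable borel" "G0 \<in> borel_measurable borel"
    using F0 G0 by (auto dest!: borel_measurable_integrable)
  define k where "k t \<tau> = (if t \<le> \<tau> then F0 t \<bullet> G0 \<tau> else 0)" for t \<tau>
  have k: "integrable (lborel \<Otimes>\<^sub>M lborel) (case_prod k)"
  proof (rule Bochner_Integration.integrable_bound)
    show "integrable (lborel \<Otimes>\<^sub>M lborel) (\<lambda>(t, \<tau>). norm (F0 t) * norm (G0 \<tau>))"
      using F0 G0 by (intro integrable_product_mult integrable_norm)
    show "case_prod k \<in> borel_measurable (lborel \<Otimes>\<^sub>M lborel)"
      unfolding k_def[abs_def] by measurable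
    show "AE p in lborel \<Otimes>\<^sub>M lborel.
        norm (case_prod k p) \<le> norm (case p of (t, \<tau>) \<Rightarrow> norm (F0 t) * norm (G0 \<tau>))"
      by (auto simp: k_def Cauchy_Schwarz_ineq2)
  qed
  have 1: "(LINT \<tau>|lborel. k t \<tau>) = indicator {a..b} t *\<^sub>R (F t \<bullet> (LINT \<tau>:{t..b}|lborel. G \<tau>))" for t
  proof (cases "t \<in> {a..b}")
    case True
    have "set_integrable lborel {t..b} G" by (rule set_integrable_subset[OF G]) (use True in auto)
    moreover have "k t \<tau> = F t \<bullet> (indicator {t..b} \<tau> *\<^sub>R G \<tau>)" for \<tau>
      using True by (auto simp: k_def F0_def G0_def indicator_def)
    ultimately show ?thesis
      using True by (simp add: set_lebesgue_integral_def set_integrable_def del: inner_scaleR_right)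
  next
    case False
    then have "k t \<tau> = 0" for \<tau> by (auto simp: k_def F0_def)
    then show ?thesis using False by simp
  qed
  have 2: "(LINT t|lborel. k t \<tau>) = indicator {a..b} \<tau> *\<^sub>R ((LINT t:{a..\<tau>}|lborel. F t) \<bullet> G \<tau>)" for \<tau>
  proof (cases "\<tau> \<in> {a..b}")
    case True
    have "set_integrable lborel {a..\<tau>} F" by (rule set_integrable_subset[OF F]) (use True in auto)
    moreover have "k t \<tau> = (indicator {a..\<tau>} t *\<^sub>R F t) \<bullet> G \<tau>" for t
      using True by (auto simp: k_def F0_def G0_def indicator_def)
    ultimately show ?thesis
      using True by (simp add: set_lebesgue_integral_def set_integrable_def del: inner_scaleR_left)
  next
    case False
    then have "k t \<tau> = 0" for t by (auto simp: k_def G0_def)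
    then show ?thesis using False by simp
  qed
  show ?thesis
    using lborel_pair.Fubini_integral[OF k] by (simp add: 1 2 set_lebesgue_integral_def)
qed

section \<open>Square integrable functions\<close>

text \<open>The zero extension turns both conditions into conditions on the whole space, where the
  facts on measurability and Bochner integrals apply directly.\<close>

lemma L2_iff:
  "f \<in> L2 S \<longleftrightarrow> (\<lambda>x. indicator S x *\<^sub>R f x) \<in> borel_measurable borel \<and>
    integrable lborel (\<lambda>x. (norm (indicator S x *\<^sub>R f x))\<^sup>2)"
proof -
  have "(\<lambda>x. indicator S x *\<^sub>R (norm (f x))\<^sup>2) = (\<lambda>x. (norm (indicator S x *\<^sub>R f x))\<^sup>2)"
    by (auto simp: indicator_def)
  then show ?thesis
    by (simp add: L2_def set_borel_measurable_def set_integrable_def)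
qed

lemma L2_bound:
  assumes f: "f \<in> L2 S" and g: "(\<lambda>x. indicator S x *\<^sub>R g x) \<in> borel_measurable borel"
    and le: "\<And>x. x \<in> S \<Longrightarrow> norm (g x) \<le> C * norm (f x)"
  shows "g \<in> L2 S"
proof -
  have "integrable lborel (\<lambda>x. (norm (indicator S x *\<^sub>R g x))\<^sup>2)"
  proof (rule Bochner_Integration.integrable_bound)
    show "integrable lborel (\<lambda>x. C\<^sup>2 * (norm (indicator S x *\<^sub>R f x))\<^sup>2)"
      using f by (simp add: L2_iff del: norm_scaleR)
    show "(\<lambda>x. (norm (indicator S x *\<^sub>R g x))\<^sup>2) \<in> borel_measurable lborel"
      using g by (auto simp del: norm_scaleR)
    have "(norm (g x))\<^sup>2 \<le> C\<^sup>2 * (norm (f x))\<^sup>2" if "x \<in> S" for x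
      using power_mono[OF le[OF that] norm_ge_zero, of 2] by (simp add: power_mult_distrib)
    then show "AE x in lborel. norm ((norm (indicator S x *\<^sub>R g x))\<^sup>2)
        \<le> norm (C\<^sup>2 * (norm (indicator S x *\<^sub>R f x))\<^sup>2)"
      by (auto simp: indicator_def)
  qed
  then show ?thesis using g by (simp add: L2_iff)
qed

lemma L2_linear:
  assumes h: "linear h" and f: "f \<in> L2 S"
  shows "(\<lambda>x. h (f x)) \<in> L2 S"
proof -
  obtain B where B: "\<And>y. norm (h y) \<le> B * norm y"
    using linear_bounded[OF h] by blast
  have hm: "h \<in> borel_measurable borel"
    using h by (intro borel_measurable_continuous_onI linear_continuous_on linear_linear[THEN iffD2])
  have "(\<lambda>x. indicator S x *\<^sub>R f x) \<in> borel_measurable borel" using f by (simp add: L2_iff)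
  from measurable_compose[OF this hm]
  have "(\<lambda>x. indicator S x *\<^sub>R h (f x)) \<in> borel_measurable borel"
    by (simp add: linear_scale[OF h])
  then show ?thesis by (rule L2_bound[OF f]) (rule B)
qed

lemma L2_add:
  assumes f: "f \<in> L2 S" and g: "g \<in> L2 S"
  shows "(\<lambda>x. f x + g x) \<in> L2 S"
proof -
  let ?f = "\<lambda>x. indicator S x *\<^sub>R f x" and ?g = "\<lambda>x. indicator S x *\<^sub>R g x"
  have [measurable]: "?f \<in> borel_measurable borel" "?g \<in> borel_measurable borel"
    using f g by (auto simp: L2_iff)
  have "integrable lborel (\<lambda>x. (norm (?f x + ?g x))\<^sup>2)"
  proof (rule Bochner_Integration.integrable_bound)
    show "integrable lborel (\<lambda>x. 2 * ((norm (?f x))\<^sup>2 + (norm (?g x))\<^sup>2))"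
      using f g by (simp add: L2_iff del: norm_scaleR)
    show "AE x in lborel. norm ((norm (?f x + ?g x))\<^sup>2) \<le> norm (2 * ((norm (?f x))\<^sup>2 + (norm (?g x))\<^sup>2))"
    proof (rule AE_I2)
      fix x
      have "(norm (?f x + ?g x))\<^sup>2 \<le> (norm (?f x) + norm (?g x))\<^sup>2"
        by (intro power_mono norm_triangle_ineq norm_ge_zero)
      also have "\<dots> \<le> 2 * ((norm (?f x))\<^sup>2 + (norm (?g x))\<^sup>2)"
        using sum_squares_bound[of "norm (?f x)" "norm (?g x)"] by (simp add: power2_sum del: norm_scaleR)
      finally show "norm ((norm (?f x + ?g x))\<^sup>2) \<le> norm (2 * ((norm (?f x))\<^sup>2 + (norm (?g x))\<^sup>2))"
        by simp
    qed
  qed measurable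
  moreover have "(\<lambda>x. ?f x + ?g x) \<in> borel_measurable borel" by measurable
  moreover have "indicator S x *\<^sub>R (f x + g x) = ?f x + ?g x" for x by (simp add: scaleR_add_right)
  ultimately show ?thesis by (simp only: L2_iff)
qed

lemma L2_zero: "(\<lambda>x. 0) \<in> L2 S"
  by (simp add: L2_iff)

lemma L2_sum: "(\<And>i. i \<in> I \<Longrightarrow> f i \<in> L2 S) \<Longrightarrow> (\<lambda>x. \<Sum>i\<in>I. f i x) \<in> L2 S"
  by (induction I rule: infinite_finite_induct) (auto intro: L2_zero L2_add)

lemma L2_diff: "f \<in> L2 S \<Longrightarrow> g \<in> L2 S \<Longrightarrow> (\<lambda>x. f x - g x) \<in> L2 S"
  using L2_add[of f S "\<lambda>x. - g x"] L2_linear[of uminus g S]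
  by (simp add: linear_iff)

lemma L2_norm_mult:
  assumes f: "f \<in> L2 S" and g: "g \<in> L2 S"
  shows "integrable lborel (\<lambda>x. norm (indicator S x *\<^sub>R f x) * norm (indicator S x *\<^sub>R g x))"
proof (rule Bochner_Integration.integrable_bound)
  let ?f = "\<lambda>x. indicator S x *\<^sub>R f x" and ?g = "\<lambda>x. indicator S x *\<^sub>R g x"
  have [measurable]: "?f \<in> borel_measurable borel" "?g \<in> borel_measurable borel"
    using f g by (auto simp: L2_iff)
  show "(\<lambda>x. norm (?f x) * norm (?g x)) \<in> borel_measurable lborel" by measurable
  show "integrable lborel (\<lambda>x. (norm (?f x))\<^sup>2 + (norm (?g x))\<^sup>2)"
    using f g by (simp add: L2_iff del: norm_scaleR)
  have "a * b \<le> a\<^sup>2 + b\<^sup>2" if "0 \<le> a" "0 \<le> b" for a b :: real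
    using sum_squares_bound[of a b] mult_nonneg_nonneg[OF that] by linarith
  then show "AE x in lborel. norm (norm (?f x) * norm (?g x)) \<le> norm ((norm (?f x))\<^sup>2 + (norm (?g x))\<^sup>2)"
    by (auto simp del: norm_scaleR)
qed

lemma L2_inner_integrable:
  assumes f: "f \<in> L2 S" and g: "g \<in> L2 S"
  shows "set_integrable lborel S (\<lambda>x. f x \<bullet> g x)"
proof -
  let ?f = "\<lambda>x. indicator S x *\<^sub>R f x" and ?g = "\<lambda>x. indicator S x *\<^sub>R g x"
  have [measurable]: "?f \<in> borel_measurable borel" "?g \<in> borel_measurable borel"
    using f g by (auto simp: L2_iff)
  have "integrable lborel (\<lambda>x. ?f x \<bullet> ?g x)"
    by (rule Bochner_Integration.integrable_bound[OF L2_norm_mult[OF f g]])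
       (measurable, auto simp: Cauchy_Schwarz_ineq2 simp del: norm_scaleR inner_scaleR_left inner_scaleR_right)
  also have "(\<lambda>x. ?f x \<bullet> ?g x) = (\<lambda>x. indicator S x *\<^sub>R (f x \<bullet> g x))"
    by (auto simp: indicator_def)
  finally show ?thesis by (simp add: set_integrable_def)
qed

lemma L2_scaleR_integrable:
  fixes f :: "'a::euclidean_space \<Rightarrow> real" and g :: "'a \<Rightarrow> 'b::euclidean_space"
  assumes f: "f \<in> L2 S" and g: "g \<in> L2 S"
  shows "set_integrable lborel S (\<lambda>x. f x *\<^sub>R g x)"
proof -
  let ?f = "\<lambda>x. indicator S x *\<^sub>R f x" and ?g = "\<lambda>x. indicator S x *\<^sub>R g x"
  have [measurable]: "?f \<in> borel_measurable borel" "?g \<in> borel_measurable borel"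
    using f g by (auto simp: L2_iff)
  have "norm (u *\<^sub>R v) \<le> norm (norm u * norm v)" for u and v :: 'b by simp
  then have "integrable lborel (\<lambda>x. ?f x *\<^sub>R ?g x)"
    by (intro Bochner_Integration.integrable_bound[OF L2_norm_mult[OF f g]] AE_I2) measurable
  also have "(\<lambda>x. ?f x *\<^sub>R ?g x) = (\<lambda>x. indicator S x *\<^sub>R (f x *\<^sub>R g x))"
    by (auto simp: indicator_def)
  finally show ?thesis by (simp add: set_integrable_def)
qed

text \<open>The integral of (s |f| - |g|)^2 is a nonnegative quadratic polynomial in
  \<open>s\<close>.\<close>

lemma L2_Cauchy_Schwarz:
  assumes f: "f \<in> L2 S" and g: "g \<in> L2 S"
  shows "(LINT x:S|lborel. norm (f x) * norm (g x))\<^sup>2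
    \<le> (LINT x:S|lborel. (norm (f x))\<^sup>2) * (LINT x:S|lborel. (norm (g x))\<^sup>2)"
proof -
  define a b c where "a = (LINT x:S|lborel. (norm (f x))\<^sup>2)"
    and "b = (LINT x:S|lborel. (norm (g x))\<^sup>2)"
    and "c = (LINT x:S|lborel. norm (f x) * norm (g x))"
  have ia: "set_integrable lborel S (\<lambda>x. (norm (f x))\<^sup>2)" and ib: "set_integrable lborel S (\<lambda>x. (norm (g x))\<^sup>2)"
    using f g by (auto simp: L2_def)
  have "(\<lambda>x. norm (indicator S x *\<^sub>R f x) * norm (indicator S x *\<^sub>R g x))
      = (\<lambda>x. indicator S x *\<^sub>R (norm (f x) * norm (g x)))"
    by (auto simp: indicator_def)
  with L2_norm_mult[OF f g] have ic: "set_integrable lborel S (\<lambda>x. norm (f x) * norm (g x))"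
    unfolding set_integrable_def by metis
  have quad: "0 \<le> s\<^sup>2 * a - 2 * s * c + b" for s
  proof -
    have "0 \<le> (LINT x:S|lborel. (s * norm (f x) - norm (g x))\<^sup>2)"
      unfolding set_lebesgue_integral_def by (intro integral_nonneg_AE) auto
    also have "(\<lambda>x. (s * norm (f x) - norm (g x))\<^sup>2)
        = (\<lambda>x. s\<^sup>2 * (norm (f x))\<^sup>2 - 2 * s * (norm (f x) * norm (g x)) + (norm (g x))\<^sup>2)"
      by (auto simp: power2_diff power_mult_distrib algebra_simps)
    also have "(LINT x:S|lborel. s\<^sup>2 * (norm (f x))\<^sup>2 - 2 * s * (norm (f x) * norm (g x)) + (norm (g x))\<^sup>2)
        = s\<^sup>2 * a - 2 * s * c + b"
      using ia ib ic by (simp add: set_integral_add set_integral_diff a_def b_def c_def)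
    finally show ?thesis .
  qed
  have "a \<ge> 0" unfolding a_def set_lebesgue_integral_def by (intro integral_nonneg_AE) auto
  have "c\<^sup>2 \<le> a * b"
  proof (cases "a = 0")
    case True
    have "c = 0"
    proof (rule ccontr)
      assume "c \<noteq> 0"
      \<comment> \<open>With a = 0 the polynomial is b - 2 s c, and this \<open>s\<close> gives it
        the value -1.\<close>
      then show False using quad[of "(b + 1) / (2 * c)"] True by simp
    qed
    then show ?thesis using True by simp
  next
    case False
    \<comment> \<open>For a > 0 the minimum is attained at s = c / a.\<close>
    then have "0 \<le> (c / a)\<^sup>2 * a - 2 * (c / a) * c + b" "0 < a"
      using quad[of "c / a"] \<open>a \<ge> 0\<close> by linarith+
    then show ?thesis by (simp add: field_simps power2_eq_square)
  qed
  then show ?thesis by (simp add: a_def b_def c_def)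
qed

section \<open>Square integrability on space-time: products, time reflection and slices\<close>

lemma L2_scaleR_Times:
  fixes \<phi> :: "'a::euclidean_space \<Rightarrow> real" and r :: "'b::euclidean_space \<Rightarrow> 'c::euclidean_space"
  assumes \<phi>: "\<phi> \<in> L2 A" and r: "r \<in> L2 B"
  shows "(\<lambda>(x, t). \<phi> x *\<^sub>R r t) \<in> L2 (A \<times> B)"
proof -
  let ?\<phi> = "\<lambda>x. indicator A x *\<^sub>R \<phi> x" and ?r = "\<lambda>t. indicator B t *\<^sub>R r t"
  have [measurable]: "?\<phi> \<in> borel_measurable borel" "?r \<in> borel_measurable borel"
    using \<phi> r by (auto simp: L2_iff)
  have eq: "indicator (A \<times> B) p *\<^sub>R (case p of (x, t) \<Rightarrow> \<phi> x *\<^sub>R r t) = (case p of (x, t) \<Rightarrow> ?\<phi> x *\<^sub>R ?r t)" for p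
    by (cases p) (auto simp: indicator_def)
  have "(\<lambda>p. (norm (case p of (x, t) \<Rightarrow> ?\<phi> x *\<^sub>R ?r t))\<^sup>2)
      = (\<lambda>(x, t). (norm (?\<phi> x))\<^sup>2 * (norm (?r t))\<^sup>2)"
    by (auto simp: fun_eq_iff power_mult_distrib)
  moreover have "integrable (lborel \<Otimes>\<^sub>M lborel) (\<lambda>(x, t). (norm (?\<phi> x))\<^sup>2 * (norm (?r t))\<^sup>2)"
    using \<phi> r by (intro integrable_product_mult) (auto simp: L2_iff simp del: norm_scaleR)
  moreover have "(\<lambda>(x, t). ?\<phi> x *\<^sub>R ?r t) \<in> borel_measurable (borel \<Otimes>\<^sub>M borel)"
    by measurable
  ultimately show ?thesis
    unfolding L2_iff eq by (simp only: lborel_prod borel_prod)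
qed

lemma L2_compose:
  fixes R :: "'a::euclidean_space \<Rightarrow> 'b::euclidean_space"
  assumes R: "R \<in> borel \<rightarrow>\<^sub>M borel" "distr lborel borel R = lborel" and f: "f \<in> L2 S"
  shows "(\<lambda>x. f (R x)) \<in> L2 (R -` S)"
proof -
  let ?f = "\<lambda>x. indicator S x *\<^sub>R f x"
  have f': "?f \<in> borel_measurable borel" "integrable lborel (\<lambda>x. (norm (?f x))\<^sup>2)"
    using f by (auto simp: L2_iff)
  have eq: "(\<lambda>x. indicator (R -` S) x *\<^sub>R f (R x)) = (\<lambda>x. ?f (R x))"
    by (auto simp: indicator_def)
  have "integrable lborel (\<lambda>x. (norm (?f (R x)))\<^sup>2)"
    by (rule integrable_distr[of R lborel borel "\<lambda>x. (norm (?f x))\<^sup>2"]) (use R f' in simp_all)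
  moreover have "(\<lambda>x. ?f (R x)) \<in> borel_measurable borel"
    using measurable_compose[OF R(1) f'(1)] .
  moreover have "(\<lambda>x. (norm (indicator (R -` S) x *\<^sub>R f (R x)))\<^sup>2) = (\<lambda>x. (norm (?f (R x)))\<^sup>2)"
    by (auto simp: indicator_def)
  ultimately show ?thesis unfolding L2_iff eq by simp
qed

lemma lborel_distr_reflect: "distr lborel borel (\<lambda>t. c - t) = (lborel :: real measure)"
  by (subst lborel_real_affine[of "-1" c]) (auto simp: density_1 one_ennreal_def[symmetric])

text \<open>Time reversal of a field is composition with this measure preserving involution. It
  therefore carries over both square integrability and statements that hold almost
  everywhere.\<close>

definition reflect_time :: "real \<Rightarrow> 'a \<times> real \<Rightarrow> 'a \<times> real" where
  "reflect_time c = (\<lambda>(x, t). (x, c - t))"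

lemma reflect_time_measurable: "reflect_time c \<in> borel \<rightarrow>\<^sub>M (borel :: ('a::euclidean_space \<times> real) measure)"
  unfolding reflect_time_def borel_prod[symmetric] by measurable

lemma lborel_distr_reflect_time:
  "distr lborel borel (reflect_time c) = (lborel :: ('a::euclidean_space \<times> real) measure)"
proof -
  have 1: "distr lborel lborel (\<lambda>t. c - t) = (lborel :: real measure)"
    using lborel_distr_reflect[of c] by (simp cong: distr_cong)
  have 2: "distr lborel lborel (\<lambda>x. x) = (lborel :: 'a measure)"
    by (simp add: distr_id2)
  have "distr lborel borel (reflect_time c)
      = distr (lborel \<Otimes>\<^sub>M lborel) (lborel \<Otimes>\<^sub>M lborel) (\<lambda>(x::'a, t). (x, c - t))"
    unfolding lborel_prod by (intro distr_cong) (simp_all add: reflect_time_def)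
  also have "\<dots> = distr lborel lborel (\<lambda>x. x) \<Otimes>\<^sub>M distr lborel lborel (\<lambda>t. c - t)"
    by (rule pair_measure_distr[symmetric]) (simp_all add: 1 sigma_finite_lborel)
  also have "\<dots> = lborel" by (simp add: 1 2 lborel_prod)
  finally show ?thesis .
qed

lemma L2_reflect_time:
  fixes f :: "'a::euclidean_space \<Rightarrow> real \<Rightarrow> 'b::euclidean_space"
  assumes "(\<lambda>(x, t). f x t) \<in> L2 (A \<times> {c - b..c - a})"
  shows "(\<lambda>(x, t). f x (c - t)) \<in> L2 (A \<times> {a..b})"
proof -
  have "reflect_time c -` (A \<times> {c - b..c - a}) = A \<times> {a..b}"
    by (auto simp: reflect_time_def)
  then show ?thesis
    using L2_compose[OF reflect_time_measurable lborel_distr_reflect_time assms, of c]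
    by (simp add: reflect_time_def case_prod_beta')
qed

lemma L2_reflect:
  fixes f :: "real \<Rightarrow> 'b::euclidean_space"
  assumes "f \<in> L2 {c - b..c - a}"
  shows "(\<lambda>t. f (c - t)) \<in> L2 {a..b}"
proof -
  have "(\<lambda>t. c - t) -` {c - b..c - a} = {a..b}" by auto
  then show ?thesis
    using L2_compose[OF _ lborel_distr_reflect assms, of c] by simp
qed

text \<open>The bound on the tensor controls the norm. Joint measurability is the real point:
  \<open>\<Gamma> x \<xi>\<close> is known to be measurable in \<open>x\<close> for each fixed
  \<open>\<xi>\<close>, so the field is expanded in the standard basis and linearity leaves a finite
  sum of products of measurable functions.\<close>

lemma L2_material_tensor:
  assumes \<Gamma>: "material_tensor \<Omega> \<Gamma>" and f: "(\<lambda>(x, t). f x t) \<in> L2 (\<Omega> \<times> I)"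
  shows "(\<lambda>(x, t). \<Gamma> x (f x t)) \<in> L2 (\<Omega> \<times> I)"
proof -
  obtain C where C: "\<And>x \<xi>. x \<in> \<Omega> \<Longrightarrow> norm (\<Gamma> x \<xi>) \<le> C * norm \<xi>"
    using \<Gamma> unfolding material_tensor_def by blast
  define G where "G b x = indicator \<Omega> x *\<^sub>R \<Gamma> x b" for b x
  define h where "h p = indicator (\<Omega> \<times> I) p *\<^sub>R (case p of (x, t) \<Rightarrow> f x t)" for p
  have [measurable]: "G b \<in> borel_measurable borel" for b
    using \<Gamma> by (auto simp: material_tensor_def set_borel_measurable_def G_def[abs_def])
  have [measurable]: "h \<in> borel_measurable (borel \<Otimes>\<^sub>M borel)"
    using f by (simp add: L2_iff borel_prod h_def[abs_def])
  have eq: "indicator (\<Omega> \<times> I) p *\<^sub>R (case p of (x, t) \<Rightarrow> \<Gamma> x (f x t))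
      = (\<Sum>b\<in>Basis. (h p \<bullet> b) *\<^sub>R G b (fst p))" for p
  proof (cases "p \<in> \<Omega> \<times> I")
    case True
    then obtain x t where p: "p = (x, t)" "x \<in> \<Omega>" "t \<in> I" by auto
    then have lin: "linear (\<Gamma> x)" using \<Gamma> by (auto simp: material_tensor_def)
    have "\<Gamma> x (f x t) = \<Gamma> x (\<Sum>b\<in>Basis. (f x t \<bullet> b) *\<^sub>R b)"
      by (simp only: euclidean_representation)
    also have "\<dots> = (\<Sum>b\<in>Basis. (f x t \<bullet> b) *\<^sub>R \<Gamma> x b)"
      by (simp only: linear_sum[OF lin] linear_scale[OF lin])
    finally show ?thesis using p by (simp add: h_def G_def)
  qed (simp add: h_def)
  have "(\<lambda>p. \<Sum>b\<in>Basis. (h p \<bullet> b) *\<^sub>R G b (fst p)) \<in> borel_measurable (borel \<Otimes>\<^sub>M borel)"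
    by measurable
  then show ?thesis
    using C by (intro L2_bound[OF f, of _ C]) (auto simp only: eq borel_prod split: prod.splits)
qed

lemma
  fixes f :: "'a::euclidean_space \<Rightarrow> 'b::euclidean_space \<Rightarrow> 'c::euclidean_space"
  assumes "set_integrable lborel (A \<times> B) (\<lambda>(x, t). f x t)"
  shows set_integral_Times_fst: "set_lebesgue_integral lborel (A \<times> B) (\<lambda>(x, t). f x t)
      = (LINT x:A|lborel. (LINT t:B|lborel. f x t))"
    and set_integral_Times_snd: "set_lebesgue_integral lborel (A \<times> B) (\<lambda>(x, t). f x t)
      = (LINT t:B|lborel. (LINT x:A|lborel. f x t))"
    and set_integrable_Times_snd: "AE t in lborel. t \<in> B \<longrightarrow> set_integrable lborel A (\<lambda>x. f x t)"
    and set_borel_measurable_Times_snd: "set_borel_measurable lborel B (\<lambda>t. LINT x:A|lborel. f x t)"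
proof -
  define k where "k x t = indicator A x *\<^sub>R indicator B t *\<^sub>R f x t" for x t
  have eq: "indicator (A \<times> B) p *\<^sub>R (case p of (x, t) \<Rightarrow> f x t) = case_prod k p" for p
    by (cases p) (simp add: k_def indicator_def)
  have k: "integrable (lborel \<Otimes>\<^sub>M lborel) (case_prod k)"
    using assms unfolding set_integrable_def eq lborel_prod .
  have 1: "(LINT t|lborel. k x t) = indicator A x *\<^sub>R (LINT t:B|lborel. f x t)" for x
    by (simp only: k_def set_lebesgue_integral_def integral_scaleR_right)
  have k': "k x t = indicator B t *\<^sub>R indicator A x *\<^sub>R f x t" for x t by (simp add: k_def)
  have 2: "(LINT x|lborel. k x t) = indicator B t *\<^sub>R (LINT x:A|lborel. f x t)" for t
    by (simp only: k' set_lebesgue_integral_def integral_scaleR_right)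
  show "set_lebesgue_integral lborel (A \<times> B) (\<lambda>(x, t). f x t)
      = (LINT x:A|lborel. (LINT t:B|lborel. f x t))"
    using lborel_pair.integral_fst[OF k]
    by (simp only: set_lebesgue_integral_def[of lborel "A \<times> B"] eq lborel_prod 1
        set_lebesgue_integral_def[of lborel A])
  show "set_lebesgue_integral lborel (A \<times> B) (\<lambda>(x, t). f x t)
      = (LINT t:B|lborel. (LINT x:A|lborel. f x t))"
    using lborel_pair.integral_snd[OF k]
    by (simp only: set_lebesgue_integral_def[of lborel "A \<times> B"] eq lborel_prod 2
        set_lebesgue_integral_def[of lborel B])
  show "AE t in lborel. t \<in> B \<longrightarrow> set_integrable lborel A (\<lambda>x. f x t)"
    using lborel_pair.AE_integrable_snd[OF k] by (auto simp: k_def set_integrable_def)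
  show "set_borel_measurable lborel B (\<lambda>t. LINT x:A|lborel. f x t)"
    using borel_measurable_integrable[OF lborel_pair.integrable_snd[OF k]]
    by (simp add: 2 set_borel_measurable_def)
qed

text \<open>Every slice over \<open>B\<close> is measurable; the exceptional null set comes from
  integrability of the squared norm.\<close>

lemma L2_snd:
  fixes u :: "'a::euclidean_space \<Rightarrow> 'b::euclidean_space \<Rightarrow> 'c::euclidean_space"
  assumes u: "(\<lambda>(x, t). u x t) \<in> L2 (A \<times> B)"
  shows "AE t in lborel. t \<in> B \<longrightarrow> (\<lambda>x. u x t) \<in> L2 A"
proof -
  have "set_integrable lborel (A \<times> B) (\<lambda>(x, t). (norm (u x t))\<^sup>2)"
    using u by (simp add: L2_def case_prod_beta')
  from set_integrable_Times_snd[OF this] show ?thesis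
  proof eventually_elim
    case (elim t)
    show ?case
    proof
      assume t: "t \<in> B"
      have "(\<lambda>p. indicator (A \<times> B) p *\<^sub>R (case p of (x, t) \<Rightarrow> u x t)) \<in> borel_measurable borel"
        using u by (simp add: L2_iff)
      from measurable_compose[OF _ this, of "\<lambda>x. (x, t)" borel]
      have "(\<lambda>x. indicator (A \<times> B) (x, t) *\<^sub>R u x t) \<in> borel_measurable borel"
        by (simp add: borel_prod[symmetric])
      moreover have "indicator (A \<times> B) (x, t) *\<^sub>R u x t = indicator A x *\<^sub>R u x t" for x
        using t by (simp add: indicator_def)
      ultimately show "(\<lambda>x. u x t) \<in> L2 A"
        using elim t by (simp add: L2_def set_borel_measurable_def)
    qed
  qed
qed

text \<open>On almost every time slice Cauchy-Schwarz bounds the squared norm of the integral by the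
  squared norm of \<open>\<phi>\<close> times that of the slice of \<open>u\<close>, and the latter
  is integrable in \<open>t\<close> by Fubini. This makes measurement a map from fields to
  signals.\<close>

lemma L2_partial_integral:
  fixes u :: "'a::euclidean_space \<Rightarrow> 'b::euclidean_space \<Rightarrow> 'c::euclidean_space"
  assumes \<phi>: "\<phi> \<in> L2 A" and u: "(\<lambda>(x, t). u x t) \<in> L2 (A \<times> B)"
  shows "(\<lambda>t. LINT x:A|lborel. \<phi> x *\<^sub>R u x t) \<in> L2 B"
proof -
  define m where "m t = (LINT x:A|lborel. \<phi> x *\<^sub>R u x t)" for t
  define b where "b t = (LINT x:A|lborel. (norm (u x t))\<^sup>2)" for t
  define a where "a = (LINT x:A|lborel. (norm (\<phi> x))\<^sup>2)"
  define \<phi>0 where "\<phi>0 x = indicator A x *\<^sub>R \<phi> x" for x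
  define u0 where "u0 p = indicator (A \<times> B) p *\<^sub>R (case p of (x, t) \<Rightarrow> u x t)" for p
  have [measurable]: "\<phi>0 \<in> borel_measurable borel" "u0 \<in> borel_measurable (borel \<Otimes>\<^sub>M borel)"
    using \<phi> u by (auto simp: L2_iff borel_prod \<phi>0_def[abs_def] u0_def[abs_def])
  \<comment> \<open>Measurability holds for all \<open>t\<close>, including times at which the slice
    is not integrable and the Bochner integral takes its default value 0.\<close>
  have "(\<lambda>t. LINT x|lborel. \<phi>0 x *\<^sub>R u0 (x, t)) \<in> borel_measurable borel"
    by measurable
  moreover have "(LINT x|lborel. \<phi>0 x *\<^sub>R u0 (x, t)) = indicator B t *\<^sub>R m t" for t
  proof -
    have "\<phi>0 x *\<^sub>R u0 (x, t) = indicator B t *\<^sub>R (indicator A x *\<^sub>R (\<phi> x *\<^sub>R u x t))" for x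
      by (simp add: \<phi>0_def u0_def indicator_def)
    then show ?thesis by (simp only: m_def set_lebesgue_integral_def integral_scaleR_right)
  qed
  ultimately have m: "(\<lambda>t. indicator B t *\<^sub>R m t) \<in> borel_measurable borel" by simp
  have u2: "set_integrable lborel (A \<times> B) (\<lambda>(x, t). (norm (u x t))\<^sup>2)"
    using u by (simp add: L2_def case_prod_beta')
  have b: "integrable lborel (\<lambda>t. indicator B t *\<^sub>R b t)"
  proof -
    have "integrable (lborel \<Otimes>\<^sub>M lborel) (\<lambda>(x, t). indicator B t *\<^sub>R (indicator A x *\<^sub>R (norm (u x t))\<^sup>2))"
      using u2 unfolding set_integrable_def lborel_prod
      by (rule Bochner_Integration.integrable_cong[THEN iffD1, rotated 2]) (auto simp: indicator_def)
    from lborel_pair.integrable_snd[OF this] show ?thesis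
      by (simp add: b_def set_lebesgue_integral_def)
  qed
  have le: "AE t in lborel. t \<in> B \<longrightarrow> (norm (m t))\<^sup>2 \<le> a * b t"
    using L2_snd[OF u]
  proof eventually_elim
    case (elim t)
    show ?case
    proof
      assume "t \<in> B"
      with elim have ut: "(\<lambda>x. u x t) \<in> L2 A" by blast
      have "norm (m t) \<le> (LINT x:A|lborel. norm (\<phi> x *\<^sub>R u x t))"
        unfolding m_def using set_integral_norm_bound[OF L2_scaleR_integrable[OF \<phi> ut]] .
      also have "\<dots> = (LINT x:A|lborel. norm (\<phi> x) * norm (u x t))" by simp
      finally have "(norm (m t))\<^sup>2 \<le> (LINT x:A|lborel. norm (\<phi> x) * norm (u x t))\<^sup>2"
        by (intro power_mono) simp_all
      also have "\<dots> \<le> a * b t"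
        unfolding a_def b_def by (rule L2_Cauchy_Schwarz[OF \<phi> ut])
      finally show "(norm (m t))\<^sup>2 \<le> a * b t" .
    qed
  qed
  have "integrable lborel (\<lambda>t. (norm (indicator B t *\<^sub>R m t))\<^sup>2)"
  proof (rule Bochner_Integration.integrable_bound)
    show "integrable lborel (\<lambda>t. a * (indicator B t *\<^sub>R b t))" using b by (rule integrable_mult_right)
    show "(\<lambda>t. (norm (indicator B t *\<^sub>R m t))\<^sup>2) \<in> borel_measurable lborel"
      using m by (simp del: norm_scaleR)
    show "AE t in lborel. norm ((norm (indicator B t *\<^sub>R m t))\<^sup>2) \<le> norm (a * (indicator B t *\<^sub>R b t))"
      using le by eventually_elim (auto simp: indicator_def)
  qed
  with m show ?thesis by (simp add: L2_iff m_def)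
qed

text \<open>For almost every \<open>t\<close> the slice of \<open>u\<close> is square integrable, so
  the inner product with the constant vector \<open>s t\<close> moves inside the spatial integral;
  Fubini then joins the two integrals.\<close>

lemma partial_integral_inner:
  fixes u :: "'a::euclidean_space \<Rightarrow> 'b::euclidean_space \<Rightarrow> 'c::euclidean_space"
  assumes \<phi>: "\<phi> \<in> L2 A" and u: "(\<lambda>(x, t). u x t) \<in> L2 (A \<times> B)" and s: "s \<in> L2 B"
  shows "(LINT t:B|lborel. (LINT x:A|lborel. \<phi> x *\<^sub>R u x t) \<bullet> s t)
    = set_lebesgue_integral lborel (A \<times> B) (\<lambda>(x, t). u x t \<bullet> (\<phi> x *\<^sub>R s t))"
proof -
  have int: "set_integrable lborel (A \<times> B) (\<lambda>(x, t). u x t \<bullet> (\<phi> x *\<^sub>R s t))"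
    using L2_inner_integrable[OF u L2_scaleR_Times[OF \<phi> s]] by (simp add: case_prod_beta')
  have "(LINT t:B|lborel. (LINT x:A|lborel. \<phi> x *\<^sub>R u x t) \<bullet> s t)
      = (LINT t:B|lborel. (LINT x:A|lborel. u x t \<bullet> (\<phi> x *\<^sub>R s t)))"
    unfolding set_lebesgue_integral_def[of lborel B]
  proof (rule integral_cong_AE)
    show "(\<lambda>t. indicator B t *\<^sub>R (LINT x:A|lborel. u x t \<bullet> (\<phi> x *\<^sub>R s t))) \<in> borel_measurable lborel"
      using set_borel_measurable_Times_snd[OF int] by (simp add: set_borel_measurable_def)
    show "(\<lambda>t. indicator B t *\<^sub>R ((LINT x:A|lborel. \<phi> x *\<^sub>R u x t) \<bullet> s t)) \<in> borel_measurable lborel"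
      using L2_inner_integrable[OF L2_partial_integral[OF \<phi> u] s]
      unfolding set_integrable_def by (rule borel_measurable_integrable)
    show "AE t in lborel. indicator B t *\<^sub>R ((LINT x:A|lborel. \<phi> x *\<^sub>R u x t) \<bullet> s t)
        = indicator B t *\<^sub>R (LINT x:A|lborel. u x t \<bullet> (\<phi> x *\<^sub>R s t))"
      using L2_snd[OF u]
    proof eventually_elim
      case (elim t)
      show ?case
      proof (cases "t \<in> B")
        case True
        then have ut: "(\<lambda>x. u x t) \<in> L2 A" using elim by blast
        have "(LINT x|lborel. indicator A x *\<^sub>R (\<phi> x *\<^sub>R u x t)) \<bullet> s t
            = (LINT x|lborel. (indicator A x *\<^sub>R (\<phi> x *\<^sub>R u x t)) \<bullet> s t)"
          using L2_scaleR_integrable[OF \<phi> ut] unfolding set_integrable_def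
          by (intro integral_inner_left[symmetric]) blast
        also have "(\<lambda>x. (indicator A x *\<^sub>R (\<phi> x *\<^sub>R u x t)) \<bullet> s t)
            = (\<lambda>x. indicator A x *\<^sub>R (u x t \<bullet> (\<phi> x *\<^sub>R s t)))"
          by (auto simp: fun_eq_iff)
        finally show ?thesis by (simp only: set_lebesgue_integral_def)
      qed simp
    qed
  qed
  also have "\<dots> = set_lebesgue_integral lborel (A \<times> B) (\<lambda>(x, t). u x t \<bullet> (\<phi> x *\<^sub>R s t))"
    by (rule set_integral_Times_snd[OF int, symmetric])
  finally show ?thesis .
qed

section \<open>Sources and measurements\<close>

lemma L2_source:
  assumes "\<And>i. g i \<in> L2 \<Omega>" "r \<in> signals a b"
  shows "(\<lambda>(x, t). source g r x t) \<in> L2 (\<Omega> \<times> {a..b})"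
proof -
  have "(\<lambda>(x, t). g i x *\<^sub>R r i t) \<in> L2 (\<Omega> \<times> {a..b})" for i
    using assms by (intro L2_scaleR_Times) (auto simp: signals_def)
  then have "(\<lambda>p. \<Sum>i\<in>UNIV. case p of (x, t) \<Rightarrow> g i x *\<^sub>R r i t) \<in> L2 (\<Omega> \<times> {a..b})"
    by (rule L2_sum)
  then show ?thesis by (simp add: source_def case_prod_beta')
qed

lemma measurement_in_signals:
  assumes "\<And>i. g i \<in> L2 \<Omega>" "(\<lambda>(x, t). u x t) \<in> L2 (\<Omega> \<times> {a..b})"
  shows "measurement \<Omega> g u \<in> signals a b"
  using L2_partial_integral[OF assms] by (simp add: signals_def measurement_def[abs_def])

text \<open>Measuring is adjoint to emitting through the same profiles, for the unweighted
  space-time pairing. The weight \<open>\<Gamma>\<close> of the inner product on U does not occur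
  here; it enters through the differential equation.\<close>

lemma signal_inner_measurement:
  assumes g: "\<And>i. g i \<in> L2 \<Omega>" and u: "(\<lambda>(x, t). u x t) \<in> L2 (\<Omega> \<times> {a..b})"
    and s: "s \<in> signals a b"
  shows "signal_inner a b (measurement \<Omega> g u) s
    = set_lebesgue_integral lborel (\<Omega> \<times> {a..b}) (\<lambda>(x, t). u x t \<bullet> source g s x t)"
proof -
  have s': "s i \<in> L2 {a..b}" for i using s by (simp add: signals_def)
  have int: "set_integrable lborel (\<Omega> \<times> {a..b}) (\<lambda>(x, t). u x t \<bullet> (g i x *\<^sub>R s i t))" for i
    using L2_inner_integrable[OF u L2_scaleR_Times[OF g s']] by (simp add: case_prod_beta')
  have "signal_inner a b (measurement \<Omega> g u) s
      = (\<Sum>i\<in>UNIV. set_lebesgue_integral lborel (\<Omega> \<times> {a..b}) (\<lambda>(x, t). u x t \<bullet> (g i x *\<^sub>R s i t)))"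
    unfolding signal_inner_def measurement_def partial_integral_inner[OF g u s'] ..
  also have "\<dots> = (LINT p|lborel. (\<Sum>i\<in>UNIV. indicator (\<Omega> \<times> {a..b}) p *\<^sub>R
      (case p of (x, t) \<Rightarrow> u x t \<bullet> (g i x *\<^sub>R s i t))))"
    using int unfolding set_integrable_def set_lebesgue_integral_def
    by (intro Bochner_Integration.integral_sum[symmetric]) blast
  also have "\<dots> = set_lebesgue_integral lborel (\<Omega> \<times> {a..b}) (\<lambda>(x, t). u x t \<bullet> source g s x t)"
    unfolding set_lebesgue_integral_def
    by (intro Bochner_Integration.integral_cong) (auto simp: source_def inner_sum_right sum_distrib_left)
  finally show ?thesis .
qed

section \<open>Time-reversible symmetric hyperbolic systems\<close>

definition flip :: "'m::real_vector \<times> 'l \<Rightarrow> 'm \<times> 'l" where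
  "flip \<xi> = (- fst \<xi>, snd \<xi>)"

lemma flip_flip [simp]: "flip (flip \<xi>) = \<xi>"
  by (simp add: flip_def)

lemma linear_flip: "linear (flip :: 'm::real_vector \<times> 'l::real_vector \<Rightarrow> _)"
  by (rule linearI) (simp_all add: flip_def)

lemma bounded_linear_flip: "bounded_linear (flip :: 'm::euclidean_space \<times> 'l::euclidean_space \<Rightarrow> _)"
  using linear_flip by (simp add: linear_linear)

lemma time_reversal_eq_flip: "time_reversal T r i t = flip (r i (2 * T - t))"
  by (simp add: time_reversal_def flip_def)

text \<open>The substitution s = 2T - \<tau> carries the interval from T to 2T - t to the one from t
  to T. The initial condition at T becomes a final condition, so the reversed function is an
  integral over the remaining time, as the integration by parts requires.\<close>

lemma time_derivative_reverse:
  fixes w w' :: "real \<Rightarrow> 'n::euclidean_space"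
  assumes w: "has_time_derivative T (2 * T) w w'" and w0: "w T = 0" and h: "linear h"
  shows "set_integrable lborel {0..T} (\<lambda>t. h (w' (2 * T - t)))"
    and "t \<in> {0..T} \<Longrightarrow> h (w (2 * T - t)) = (LINT \<tau>:{t..T}|lborel. h (w' (2 * T - \<tau>)))"
proof -
  have h': "bounded_linear h" using h by (simp add: linear_linear)
  have int: "integrable lborel (\<lambda>s. indicator {T..2 * T - t} s *\<^sub>R w' s)" if "t \<ge> 0" for t
    using set_integrable_subset[of lborel "{T..2 * T}" w' "{T..2 * T - t}"] w that
    by (auto simp: has_time_derivative_def set_integrable_def)
  have ind: "indicator {T..2 * T - t} (2 * T - \<tau>) = (indicator {t..T} \<tau> :: real)" for t \<tau>
    by (auto simp: indicator_def)
  have *: "integrable lborel (\<lambda>\<tau>. indicator {t..T} \<tau> *\<^sub>R w' (2 * T - \<tau>))" if "t \<ge> 0" for t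
    using lborel_integrable_real_affine[OF int[OF that], of "-1" "2 * T"] by (simp add: ind)
  have **: "integrable lborel (\<lambda>\<tau>. indicator {t..T} \<tau> *\<^sub>R h (w' (2 * T - \<tau>)))" if "t \<ge> 0" for t
    using integrable_bounded_linear[OF h' *[OF that]] by (simp add: linear_scale[OF h])
  from **[of 0] show "set_integrable lborel {0..T} (\<lambda>t. h (w' (2 * T - t)))"
    by (simp add: set_integrable_def)
  show "h (w (2 * T - t)) = (LINT \<tau>:{t..T}|lborel. h (w' (2 * T - \<tau>)))" if t: "t \<in> {0..T}"
  proof -
    have "2 * T - t \<in> {T..2 * T}" using t by auto
    then have "w (2 * T - t) = (LINT s:{T..2 * T - t}|lborel. w' s)"
      using w w0 by (simp add: has_time_derivative_def)
    also have "\<dots> = (LINT \<tau>|lborel. indicator {t..T} \<tau> *\<^sub>R w' (2 * T - \<tau>))"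
      unfolding set_lebesgue_integral_def
      by (subst lborel_integral_real_affine[of "-1" _ "2 * T"]) (simp_all add: ind)
    finally show ?thesis
      using integral_bounded_linear[OF h' *, of t] t
      by (simp add: set_lebesgue_integral_def linear_scale[OF h])
  qed
qed

text \<open>The product rule for <A u, z>, which vanishes on the frontier together with
  \<open>u\<close>. Since \<open>A\<close> is constant in space, no derivative of a coefficient
  arises.\<close>

lemma integral_directional_derivative_inner:
  fixes u z :: "'a::euclidean_space \<Rightarrow> 'n::euclidean_space"
  assumes \<Omega>: "open \<Omega>" and A: "linear A"
    and cont: "continuous_on (closure \<Omega>) u" "continuous_on (closure \<Omega>) z"
    and u0: "\<And>x. x \<in> frontier \<Omega> \<Longrightarrow> u x = 0"
    and der: "\<And>x. x \<in> \<Omega> \<Longrightarrow> (u has_derivative u' x) (at x)" "\<And>x. x \<in> \<Omega> \<Longrightarrow> (z has_derivative z' x) (at x)"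
    and int: "set_integrable lborel \<Omega> (\<lambda>x. A (u x) \<bullet> z x)"
      "set_integrable lborel \<Omega> (\<lambda>x. A (u' x e) \<bullet> z x + A (u x) \<bullet> z' x e)"
  shows "(LINT x:\<Omega>|lborel. A (u' x e) \<bullet> z x + A (u x) \<bullet> z' x e) = 0"
proof -
  have A': "bounded_linear A" using A by (simp add: linear_linear)
  have "((\<lambda>x. A (u x) \<bullet> z x) has_derivative (\<lambda>h. A (u' x h) \<bullet> z x + A (u x) \<bullet> z' x h)) (at x)"
    if "x \<in> \<Omega>" for x
    using has_derivative_inner[OF bounded_linear.has_derivative[OF A' der(1)[OF that]] der(2)[OF that]]
    by (simp add: add.commute)
  moreover have "continuous_on (closure \<Omega>) (\<lambda>x. A (u x) \<bullet> z x)"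
    by (intro continuous_on_inner bounded_linear.continuous_on[OF A'] cont)
  ultimately show ?thesis
    using integral_directional_derivative_eq_0[OF \<Omega>, of "\<lambda>x. A (u x) \<bullet> z x"
        "\<lambda>x h. A (u' x h) \<bullet> z x + A (u x) \<bullet> z' x h" e] u0 int linear_0[OF A]
    by simp
qed

text \<open>The common structure of both systems, with \<open>flip\<close> as J. Space-dependent
  coefficients occur only in the undifferentiated terms \<open>\<Gamma>\<close> and
  \<open>S\<close>, while the flux matrices \<open>A i\<close> are constant. Symmetry of
  \<open>S\<close> is stated on \<open>\<Omega>\<close> only, because the conductivity is
  constrained only there.\<close>

locale time_reversible_system =
  fixes \<Omega> :: "(real^3) set"
    and \<Gamma> S :: "real^3 \<Rightarrow> 'm::euclidean_space \<times> 'l::euclidean_space \<Rightarrow> 'm \<times> 'l"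
    and A :: "3 \<Rightarrow> 'm \<times> 'l \<Rightarrow> 'm \<times> 'l"
  assumes open_\<Omega>: "open \<Omega>"
    and \<Gamma>: "material_tensor \<Omega> \<Gamma>"
    and A_linear: "linear (A i)"
    and A_symmetric: "A i \<xi> \<bullet> \<eta> = \<xi> \<bullet> A i \<eta>"
    and A_flip: "A i (flip \<xi>) = - flip (A i \<xi>)"
    and \<Gamma>_flip: "\<Gamma> x (flip \<xi>) = flip (\<Gamma> x \<xi>)"
    and S_flip: "S x (flip \<xi>) = flip (S x \<xi>)"
    and S_symmetric: "x \<in> \<Omega> \<Longrightarrow> S x \<xi> \<bullet> \<eta> = \<xi> \<bullet> S x \<eta>"
begin

definition solves :: "real \<Rightarrow> real \<Rightarrow> ('m \<times> 'l) field \<Rightarrow> ('m \<times> 'l) field \<Rightarrow> bool" where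
  "solves a b q u \<longleftrightarrow>
     u \<in> field_space \<Omega> \<Gamma> a b \<and>
     (\<exists>u'. regular_field \<Omega> a b u u' \<and>
       (\<forall>x\<in>\<Omega>. u x a = 0) \<and>
       (AE (x, t) in lborel. x \<in> \<Omega> \<and> t \<in> {a..b} \<longrightarrow>
          \<Gamma> x (u' x t) + (\<Sum>i\<in>UNIV. A i (partial i (\<lambda>y. u y t) x)) + S x (u x t) = q x t))"

lemma \<Gamma>_linear: "x \<in> \<Omega> \<Longrightarrow> linear (\<Gamma> x)"
  and \<Gamma>_symmetric: "x \<in> \<Omega> \<Longrightarrow> \<Gamma> x \<xi> \<bullet> \<eta> = \<xi> \<bullet> \<Gamma> x \<eta>"
  using \<Gamma> unfolding material_tensor_def by blast+

lemma solves_L2: "solves a b q u \<Longrightarrow> (\<lambda>(x, t). u x t) \<in> L2 (\<Omega> \<times> {a..b})"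
  by (simp add: solves_def field_space_def)

text \<open>The two integrations use different slices: time lines over every point of
  \<open>\<Omega>\<close>, and space slices at almost every time. All factors are square integrable
  on the cylinder, so Fubini turns both families of identities into identities on
  space-time.\<close>

lemma duality:
  assumes u: "solves 0 T q u" and w: "solves T (2 * T) p w"
    and q: "(\<lambda>(x, t). q x t) \<in> L2 (\<Omega> \<times> {0..T})"
    and p: "(\<lambda>(x, t). p x t) \<in> L2 (\<Omega> \<times> {T..2 * T})"
  shows "set_lebesgue_integral lborel (\<Omega> \<times> {0..T}) (\<lambda>(x, t). q x t \<bullet> flip (w x (2 * T - t)))
    = set_lebesgue_integral lborel (\<Omega> \<times> {0..T}) (\<lambda>(x, t). u x t \<bullet> flip (p x (2 * T - t)))"
proof -
  let ?Q = "\<Omega> \<times> {0..T}"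
  obtain u' where u': "regular_field \<Omega> 0 T u u'" "\<And>x. x \<in> \<Omega> \<Longrightarrow> u x 0 = 0"
    and u_eq: "AE (x, t) in lborel. x \<in> \<Omega> \<and> t \<in> {0..T} \<longrightarrow>
          \<Gamma> x (u' x t) + (\<Sum>i\<in>UNIV. A i (partial i (\<lambda>y. u y t) x)) + S x (u x t) = q x t"
    using u unfolding solves_def by blast
  obtain w' where w': "regular_field \<Omega> T (2 * T) w w'" "\<And>x. x \<in> \<Omega> \<Longrightarrow> w x T = 0"
    and w_eq: "AE (x, t) in lborel. x \<in> \<Omega> \<and> t \<in> {T..2 * T} \<longrightarrow>
          \<Gamma> x (w' x t) + (\<Sum>i\<in>UNIV. A i (partial i (\<lambda>y. w y t) x)) + S x (w x t) = p x t"
    using w unfolding solves_def by blast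
  define z where "z x t = flip (w x (2 * T - t))" for x t
  \<comment> \<open>\<open>z'\<close> is minus the time derivative of \<open>z\<close>\<close>
  define z' where "z' x t = flip (w' x (2 * T - t))" for x t
  define du where "du i x t = partial i (\<lambda>y. u y t) x" for i x t
  define dz where "dz i x t = flip (partial i (\<lambda>y. w y (2 * T - t)) x)" for i x t
  define P where "P x t = flip (p x (2 * T - t))" for x t
  have L2_reverse: "(\<lambda>(x, t). flip (f x (2 * T - t))) \<in> L2 ?Q"
    if "(\<lambda>(x, t). f x t) \<in> L2 (\<Omega> \<times> {T..2 * T})" for f :: "('m \<times> 'l) field"
    using L2_linear[OF linear_flip L2_reflect_time[of f \<Omega> "2 * T" T 0]] that
    by (simp add: case_prod_beta')
  have L2u: "(\<lambda>(x, t). u x t) \<in> L2 ?Q" "(\<lambda>(x, t). u' x t) \<in> L2 ?Q" "\<And>i. (\<lambda>(x, t). du i x t) \<in> L2 ?Q"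
    using solves_L2[OF u] u'(1) by (auto simp: regular_field_def du_def)
  have L2z: "(\<lambda>(x, t). z x t) \<in> L2 ?Q" "(\<lambda>(x, t). z' x t) \<in> L2 ?Q" "\<And>i. (\<lambda>(x, t). dz i x t) \<in> L2 ?Q"
    "(\<lambda>(x, t). P x t) \<in> L2 ?Q"
    unfolding z_def z'_def dz_def P_def
    using solves_L2[OF w] w'(1) p by (auto intro!: L2_reverse simp: regular_field_def)
  have L2\<Gamma>: "(\<lambda>(x, t). \<Gamma> x (u' x t)) \<in> L2 ?Q" "(\<lambda>(x, t). \<Gamma> x (z' x t)) \<in> L2 ?Q"
    using L2_material_tensor[OF \<Gamma>] L2u(2) L2z(2) by blast+
  have L2A: "(\<lambda>(x, t). A i (du i x t)) \<in> L2 ?Q" "(\<lambda>(x, t). A i (dz i x t)) \<in> L2 ?Q"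
    "(\<lambda>(x, t). A i (u x t)) \<in> L2 ?Q" for i
    using L2_linear[OF A_linear L2u(3)] L2_linear[OF A_linear L2z(3)] L2_linear[OF A_linear L2u(1)]
    by (simp_all add: case_prod_beta')
  have inner: "set_integrable lborel ?Q (\<lambda>(x, t). f x t \<bullet> g x t)"
    if "(\<lambda>(x, t). f x t) \<in> L2 ?Q" "(\<lambda>(x, t). g x t) \<in> L2 ?Q" for f g :: "('m \<times> 'l) field"
    using L2_inner_integrable[OF that] by (simp add: case_prod_beta')
  have time: "set_lebesgue_integral lborel ?Q (\<lambda>(x, t). \<Gamma> x (u' x t) \<bullet> z x t)
      = set_lebesgue_integral lborel ?Q (\<lambda>(x, t). u x t \<bullet> \<Gamma> x (z' x t))"
  proof -
    have "(LINT t:{0..T}|lborel. \<Gamma> x (u' x t) \<bullet> z x t) = (LINT t:{0..T}|lborel. u x t \<bullet> \<Gamma> x (z' x t))"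
      if x: "x \<in> \<Omega>" for x
    proof -
      have ux: "set_integrable lborel {0..T} (u' x)"
        "\<And>t. t \<in> {0..T} \<Longrightarrow> u x t = (LINT \<tau>:{0..t}|lborel. u' x \<tau>)"
        using u' x by (auto simp: regular_field_def has_time_derivative_def)
      have "has_time_derivative T (2 * T) (w x) (w' x)" using w'(1) x by (simp add: regular_field_def)
      note wx = time_derivative_reverse[OF this w'(2)[OF x] linear_flip]
      \<comment> \<open>The tensor does not depend on time, so it commutes with the time integral of
        \<open>u'\<close>; its symmetry later moves it to \<open>z'\<close>.\<close>
      have \<Gamma>': "bounded_linear (\<Gamma> x)" using \<Gamma>_linear[OF x] by (simp add: linear_linear)
      have \<Gamma>u: "set_integrable lborel {0..T} (\<lambda>t. \<Gamma> x (u' x t))"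
        using integrable_bounded_linear[OF \<Gamma>' ux(1)[unfolded set_integrable_def]]
        by (simp add: set_integrable_def linear_scale[OF \<Gamma>_linear[OF x]])
      have "(LINT t:{0..T}|lborel. \<Gamma> x (u' x t) \<bullet> z x t)
          = (LINT t:{0..T}|lborel. \<Gamma> x (u' x t) \<bullet> (LINT \<tau>:{t..T}|lborel. z' x \<tau>))"
        by (intro set_lebesgue_integral_cong) (auto simp: z_def z'_def wx(2))
      also have "\<dots> = (LINT \<tau>:{0..T}|lborel. (LINT t:{0..\<tau>}|lborel. \<Gamma> x (u' x t)) \<bullet> z' x \<tau>)"
        using absolutely_continuous_integral_by_parts[OF \<Gamma>u wx(1)] by (simp add: z'_def)
      also have "\<dots> = (LINT \<tau>:{0..T}|lborel. u x \<tau> \<bullet> \<Gamma> x (z' x \<tau>))"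
      proof (intro set_lebesgue_integral_cong allI impI)
        fix \<tau> assume \<tau>: "\<tau> \<in> {0..T}"
        have "set_integrable lborel {0..\<tau>} (u' x)"
          by (rule set_integrable_subset[OF ux(1)]) (use \<tau> in auto)
        from integral_bounded_linear[OF \<Gamma>' this[unfolded set_integrable_def]]
        have "\<Gamma> x (u x \<tau>) = (LINT t:{0..\<tau>}|lborel. \<Gamma> x (u' x t))"
          using ux(2)[OF \<tau>] by (simp add: set_lebesgue_integral_def linear_scale[OF \<Gamma>_linear[OF x]])
        then show "(LINT t:{0..\<tau>}|lborel. \<Gamma> x (u' x t)) \<bullet> z' x \<tau> = u x \<tau> \<bullet> \<Gamma> x (z' x \<tau>)"
          using \<Gamma>_symmetric[OF x] by metis
      qed simp
      finally show ?thesis .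
    qed
    then have "(LINT x:\<Omega>|lborel. (LINT t:{0..T}|lborel. \<Gamma> x (u' x t) \<bullet> z x t))
        = (LINT x:\<Omega>|lborel. (LINT t:{0..T}|lborel. u x t \<bullet> \<Gamma> x (z' x t)))"
      using open_\<Omega> by (intro set_lebesgue_integral_cong) auto
    then show ?thesis
      using set_integral_Times_fst[OF inner[OF L2\<Gamma>(1) L2z(1)]]
        set_integral_Times_fst[OF inner[OF L2u(1) L2\<Gamma>(2)]] by simp
  qed
  have space_int: "set_integrable lborel ?Q (\<lambda>(x, t). A i (du i x t) \<bullet> z x t + A i (u x t) \<bullet> dz i x t)" for i
    using set_integral_add(1)[OF inner[OF L2A(1) L2z(1)] inner[OF L2A(3) L2z(3)]]
    by (simp add: case_prod_beta')
  have space: "set_lebesgue_integral lborel ?Q (\<lambda>(x, t). A i (du i x t) \<bullet> z x t + A i (u x t) \<bullet> dz i x t) = 0" for i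
  proof -
    \<comment> \<open>Continuity, differentiability and boundary values are available at every time
      in the interval; integrability over the slice excludes a null set of times.\<close>
    have "AE t in lborel. indicator {0..T} t *\<^sub>R (LINT x:\<Omega>|lborel. A i (du i x t) \<bullet> z x t + A i (u x t) \<bullet> dz i x t) = 0"
      using set_integrable_Times_snd[OF space_int[of i]]
        set_integrable_Times_snd[OF inner[OF L2A(3) L2z(1)], of i]
    proof eventually_elim
      case (elim t)
      show ?case
      proof (cases "t \<in> {0..T}")
        case t: True
        then have t': "2 * T - t \<in> {T..2 * T}" by auto
        have ut: "continuous_on (closure \<Omega>) (\<lambda>x. u x t)"
          "\<And>x. x \<in> frontier \<Omega> \<Longrightarrow> u x t = 0"
          "\<And>x. x \<in> \<Omega> \<Longrightarrow> ((\<lambda>y. u y t) has_derivative frechet_derivative (\<lambda>y. u y t) (at x)) (at x)"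
          using t u u'(1)
          by (auto simp: regular_field_def solves_def field_space_def frechet_derivative_works[symmetric])
        have wt: "continuous_on (closure \<Omega>) (\<lambda>x. w x (2 * T - t))"
          "\<And>x. x \<in> \<Omega> \<Longrightarrow> ((\<lambda>y. w y (2 * T - t)) has_derivative
            frechet_derivative (\<lambda>y. w y (2 * T - t)) (at x)) (at x)"
          using t' w'(1) by (auto simp: regular_field_def frechet_derivative_works[symmetric])
        have zt: "continuous_on (closure \<Omega>) (\<lambda>x. z x t)"
          "\<And>x. x \<in> \<Omega> \<Longrightarrow> ((\<lambda>y. z y t) has_derivative
            (\<lambda>h. flip (frechet_derivative (\<lambda>y. w y (2 * T - t)) (at x) h))) (at x)"
          unfolding z_def
          using bounded_linear.continuous_on[OF bounded_linear_flip wt(1)]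
            bounded_linear.has_derivative[OF bounded_linear_flip wt(2)] by auto
        have "(LINT x:\<Omega>|lborel. A i (du i x t) \<bullet> z x t + A i (u x t) \<bullet> dz i x t) = 0"
          unfolding du_def dz_def partial_def
          by (rule integral_directional_derivative_inner[OF open_\<Omega> A_linear ut(1) zt(1) ut(2) ut(3) zt(2)])
             (use elim t in \<open>auto simp: du_def dz_def partial_def\<close>)
        then show ?thesis by simp
      qed simp
    qed
    then have "(LINT t:{0..T}|lborel. (LINT x:\<Omega>|lborel. A i (du i x t) \<bullet> z x t + A i (u x t) \<bullet> dz i x t)) = 0"
      unfolding set_lebesgue_integral_def[of lborel "{0..T}"] by (rule integral_eq_zero_AE)
    then show ?thesis using set_integral_Times_snd[OF space_int[of i]] by simp
  qed
  \<comment> \<open>The exceptional set of the equation for \<open>w\<close> lies over the later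
    interval; its preimage under the reflection is again a null set.\<close>
  have "AE y in lborel. case reflect_time (2 * T) y of (x, t) \<Rightarrow> x \<in> \<Omega> \<and> t \<in> {T..2 * T} \<longrightarrow>
      \<Gamma> x (w' x t) + (\<Sum>i\<in>UNIV. A i (partial i (\<lambda>y. w y t) x)) + S x (w x t) = p x t"
  proof (rule AE_distrD[of "reflect_time (2 * T)" lborel borel])
    show "AE y in distr lborel borel (reflect_time (2 * T)). case y of (x, t) \<Rightarrow> x \<in> \<Omega> \<and> t \<in> {T..2 * T} \<longrightarrow>
        \<Gamma> x (w' x t) + (\<Sum>i\<in>UNIV. A i (partial i (\<lambda>y. w y t) x)) + S x (w x t) = p x t"
      unfolding lborel_distr_reflect_time by (rule w_eq)
  qed (simp add: reflect_time_measurable)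
  then have z_eq: "AE (x, t) in lborel. x \<in> \<Omega> \<and> t \<in> {0..T} \<longrightarrow>
      \<Gamma> x (z' x t) - (\<Sum>i\<in>UNIV. A i (dz i x t)) + S x (z x t) = P x t"
  proof eventually_elim
    case (elim y)
    obtain x t where [simp]: "y = (x, t)" by (cases y)
    show ?case
    proof (clarsimp)
      assume x: "x \<in> \<Omega>" and t: "0 \<le> t" "t \<le> T"
      then have "\<Gamma> x (w' x (2 * T - t)) + (\<Sum>i\<in>UNIV. A i (partial i (\<lambda>y. w y (2 * T - t)) x))
          + S x (w x (2 * T - t)) = p x (2 * T - t)"
        using elim by (simp add: reflect_time_def)
      then have "P x t = flip (\<Gamma> x (w' x (2 * T - t)) + (\<Sum>i\<in>UNIV. A i (partial i (\<lambda>y. w y (2 * T - t)) x))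
          + S x (w x (2 * T - t)))" by (simp add: P_def)
      \<comment> \<open>Moving \<open>flip\<close> inwards changes the sign of the flux terms alone.
        The time term keeps its sign because \<open>z'\<close> is minus the time derivative of
        \<open>z\<close>.\<close>
      also have "\<dots> = \<Gamma> x (z' x t) - (\<Sum>i\<in>UNIV. A i (dz i x t)) + S x (z x t)"
        by (simp add: linear_add[OF linear_flip] linear_sum[OF linear_flip] z'_def z_def dz_def
            \<Gamma>_flip S_flip A_flip sum_negf)
      finally show "\<Gamma> x (z' x t) - (\<Sum>i\<in>UNIV. A i (dz i x t)) + S x (z x t) = P x t" ..
    qed
  qed
  let ?I = "\<lambda>f. set_lebesgue_integral lborel ?Q (\<lambda>(x, t). f x t)"
  \<comment> \<open>After both equations are inserted into q . z - u . P, the contributions of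
    \<open>S\<close> cancel by symmetry and \<open>D\<close> remains. The minus sign before the
    second term again reflects the sign convention for \<open>z'\<close>.\<close>
  define D where "D x t = \<Gamma> x (u' x t) \<bullet> z x t - u x t \<bullet> \<Gamma> x (z' x t)
      + (\<Sum>i\<in>UNIV. A i (du i x t) \<bullet> z x t + A i (u x t) \<bullet> dz i x t)" for x t
  have sum_eq: "indicator ?Q y *\<^sub>R (case y of (x, t) \<Rightarrow> \<Sum>i\<in>UNIV. A i (du i x t) \<bullet> z x t + A i (u x t) \<bullet> dz i x t)
      = (\<Sum>i\<in>UNIV. indicator ?Q y *\<^sub>R (case y of (x, t) \<Rightarrow> A i (du i x t) \<bullet> z x t + A i (u x t) \<bullet> dz i x t))" for y
    by (cases y) (simp only: prod.case scaleR_sum_right)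
  have sum_int: "set_integrable lborel ?Q
      (\<lambda>(x, t). \<Sum>i\<in>UNIV. A i (du i x t) \<bullet> z x t + A i (u x t) \<bullet> dz i x t)"
    using space_int unfolding set_integrable_def sum_eq by (intro Bochner_Integration.integrable_sum)
  have diff_int: "set_integrable lborel ?Q (\<lambda>(x, t). \<Gamma> x (u' x t) \<bullet> z x t - u x t \<bullet> \<Gamma> x (z' x t))"
    using set_integral_diff(1)[OF inner[OF L2\<Gamma>(1) L2z(1)] inner[OF L2u(1) L2\<Gamma>(2)]]
    by (simp add: case_prod_beta')
  have sum_0: "?I (\<lambda>x t. \<Sum>i\<in>UNIV. A i (du i x t) \<bullet> z x t + A i (u x t) \<bullet> dz i x t) = 0"
    using space_int space unfolding set_lebesgue_integral_def set_integrable_def sum_eq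
    by (subst Bochner_Integration.integral_sum) simp_all
  have diff_0: "?I (\<lambda>x t. \<Gamma> x (u' x t) \<bullet> z x t - u x t \<bullet> \<Gamma> x (z' x t)) = 0"
    using set_integral_diff(2)[OF inner[OF L2\<Gamma>(1) L2z(1)] inner[OF L2u(1) L2\<Gamma>(2)]] time
    by (simp add: case_prod_beta')
  have D_0: "?I D = 0"
    using set_integral_add(2)[OF diff_int sum_int] diff_0 sum_0
    by (simp add: D_def case_prod_beta')
  have D_int: "set_integrable lborel ?Q (\<lambda>(x, t). D x t)"
    using set_integral_add(1)[OF diff_int sum_int] by (simp add: D_def case_prod_beta')
  have D_eq: "AE (x, t) in lborel. x \<in> \<Omega> \<and> t \<in> {0..T} \<longrightarrow> q x t \<bullet> z x t - u x t \<bullet> P x t = D x t"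
    using u_eq z_eq
  proof eventually_elim
    case (elim y)
    obtain x t where [simp]: "y = (x, t)" by (cases y)
    show ?case
    proof (clarsimp)
      assume x: "x \<in> \<Omega>" and t: "0 \<le> t" "t \<le> T"
      have q: "q x t = \<Gamma> x (u' x t) + (\<Sum>i\<in>UNIV. A i (du i x t)) + S x (u x t)"
        and P: "P x t = \<Gamma> x (z' x t) - (\<Sum>i\<in>UNIV. A i (dz i x t)) + S x (z x t)"
        using elim x t by (auto simp: du_def)
      show "q x t \<bullet> z x t - u x t \<bullet> P x t = D x t"
        unfolding q P D_def
        by (simp add: inner_add_left inner_add_right inner_diff_right inner_sum_left inner_sum_right
            S_symmetric[OF x] A_symmetric[of _ "u x t"] sum.distrib)
    qed
  qed
  have "set_integrable lborel ?Q (\<lambda>(x, t). q x t \<bullet> z x t - u x t \<bullet> P x t)"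
    using set_integral_diff(1)[OF inner[OF q L2z(1)] inner[OF L2u(1) L2z(4)]]
    by (simp add: case_prod_beta')
  then have "?I (\<lambda>x t. q x t \<bullet> z x t - u x t \<bullet> P x t) = ?I D"
    using D_int D_eq unfolding set_lebesgue_integral_def set_integrable_def
    by (intro integral_cong_AE borel_measurable_integrable)
       (auto simp: indicator_eq_0_iff elim!: eventually_mono)
  moreover have "?I (\<lambda>x t. q x t \<bullet> z x t - u x t \<bullet> P x t) = ?I (\<lambda>x t. q x t \<bullet> z x t) - ?I (\<lambda>x t. u x t \<bullet> P x t)"
    using set_integral_diff(2)[OF inner[OF q L2z(1)] inner[OF L2u(1) L2z(4)]]
    by (simp add: case_prod_beta')
  ultimately show ?thesis using D_0 by (simp add: z_def P_def)
qed

end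

section \<open>Mirrors, signal pairings and adjoints\<close>

lemma time_reversal_in_signals:
  fixes s :: "('i::finite, 'm::euclidean_space \<times> 'l::euclidean_space) signal"
  assumes "\<And>i. s i \<in> L2 {2 * T - b..2 * T - a}"
  shows "time_reversal T s \<in> signals a b"
  using L2_linear[OF linear_flip L2_reflect[OF assms]]
  by (simp add: signals_def time_reversal_eq_flip[abs_def])

lemma time_reversal_measurement:
  fixes u :: "('m::euclidean_space \<times> 'l::euclidean_space) field"
  shows "time_reversal T (measurement \<Omega> g u) = measurement \<Omega> g (\<lambda>x t. flip (u x (2 * T - t)))"
proof (intro ext)
  fix i t
  \<comment> \<open>As \<open>flip\<close> is its own inverse, it commutes with the integral even
    where the integrand is not integrable: both integrals are then 0.\<close>
  have "(LINT x|lborel. flip (indicator \<Omega> x *\<^sub>R (g i x *\<^sub>R u x (2 * T - t))))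
      = flip (LINT x|lborel. indicator \<Omega> x *\<^sub>R (g i x *\<^sub>R u x (2 * T - t)))"
    by (rule integral_bounded_linear'[OF bounded_linear_flip bounded_linear_flip]) simp
  then show "time_reversal T (measurement \<Omega> g u) i t
      = measurement \<Omega> g (\<lambda>x t. flip (u x (2 * T - t))) i t"
    by (simp add: time_reversal_eq_flip measurement_def set_lebesgue_integral_def
        linear_scale[OF linear_flip])
qed

text \<open>The reflection and sign change in the adjoint source undo the mirror applied at the
  users. The right-hand side of \<open>duality\<close> thus becomes a pairing with the source of the
  original signal \<open>s\<close>.\<close>

lemma flip_source_time_reversal:
  "flip (source g (time_reversal T s) x (2 * T - t)) = source g s x t"
  by (simp add: source_def time_reversal_eq_flip linear_sum[OF linear_flip] linear_scale[OF linear_flip])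

lemma signal_inner_commute: "signal_inner a b r s = signal_inner a b s r"
  by (simp add: signal_inner_def inner_commute)

lemma signal_inner_diff_right:
  assumes "r \<in> signals a b" "s \<in> signals a b" "s' \<in> signals a b"
  shows "signal_inner a b r (\<lambda>i t. s i t - s' i t) = signal_inner a b r s - signal_inner a b r s'"
proof -
  have "set_integrable lborel {a..b} (\<lambda>t. r i t \<bullet> s i t)"
    "set_integrable lborel {a..b} (\<lambda>t. r i t \<bullet> s' i t)" for i
    using assms by (auto intro!: L2_inner_integrable simp: signals_def)
  then show ?thesis
    by (simp add: signal_inner_def inner_diff_right set_integral_diff sum_subtractf)
qed

text \<open>Testing both adjoint identities with the difference \<open>D\<close> of the two images
  shows that \<open>D\<close> has norm 0, hence vanishes almost everywhere on the interval.\<close>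

lemma is_adjoint_unique:
  assumes C: "is_adjoint a b A C" and C': "is_adjoint a b A C'" and s: "s \<in> signals a b"
  shows "signal_eq a b (C' s) (C s)"
proof -
  define D where "D i t = C' s i t - C s i t" for i t
  have Cs: "C s \<in> signals a b" "C' s \<in> signals a b" using C C' s by (auto simp: is_adjoint_def)
  then have D: "D \<in> signals a b"
    by (auto simp: signals_def D_def[abs_def] intro!: L2_diff)
  have "signal_inner a b D (C' s) = signal_inner a b D (C s)"
    using C C' D s by (simp add: is_adjoint_def)
  then have 0: "signal_inner a b D D = 0"
    using signal_inner_diff_right[OF D Cs(2,1)] by (simp add: D_def[abs_def, symmetric])
  have int: "set_integrable lborel {a..b} (\<lambda>t. D i t \<bullet> D i t)" for i
    using D by (auto intro!: L2_inner_integrable simp: signals_def)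
  have "(LINT t:{a..b}|lborel. D i t \<bullet> D i t) = 0" for i
    using 0 unfolding signal_inner_def
    by (subst (asm) sum_nonneg_eq_0_iff) (auto simp: set_lebesgue_integral_def)
  then have "AE t in lborel. indicator {a..b} t *\<^sub>R (D i t \<bullet> D i t) = 0" for i
    using integral_nonneg_eq_0_iff_AE[OF int[unfolded set_integrable_def], of i]
    by (simp add: set_lebesgue_integral_def)
  then have "AE t in lborel. t \<in> {a..b} \<longrightarrow> C' s i t = C s i t" for i
    by (rule eventually_mono) (auto simp: D_def indicator_def split: if_splits)
  then show ?thesis by (simp add: signal_eq_def)
qed

context time_reversible_system
begin

text \<open>\<open>F\<close> and \<open>F'\<close> may be any maps that select solutions, on the
  earlier and the later interval. The mirror after the measurement is absorbed into the reversed
  field \<open>z\<close>, and \<open>duality\<close> exchanges the roles of emission and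
  reception.\<close>

lemma adjoint_communication:
  fixes g :: "'k::finite \<Rightarrow> real^3 \<Rightarrow> real" and h :: "'j::finite \<Rightarrow> real^3 \<Rightarrow> real"
  assumes g: "\<And>k. g k \<in> L2 \<Omega>" and h: "\<And>j. h j \<in> L2 \<Omega>"
    and F: "\<And>r. r \<in> signals 0 T \<Longrightarrow> solves 0 T (source g r) (F (source g r))"
    and F': "\<And>s. s \<in> signals T (2 * T) \<Longrightarrow> solves T (2 * T) (source h s) (F' (source h s))"
  shows "adjoint_equals 0 T (communication \<Omega> F g h)
    (time_reversal T \<circ> communication \<Omega> F' h g \<circ> time_reversal T)"
proof -
  let ?C = "time_reversal T \<circ> communication \<Omega> F' h g \<circ> time_reversal T"
  have adj: "is_adjoint 0 T (communication \<Omega> F g h) ?C"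
    unfolding is_adjoint_def
  proof (intro conjI ballI)
    fix r :: "('k, 'm \<times> 'l) signal" assume r: "r \<in> signals 0 T"
    show "communication \<Omega> F g h r \<in> signals 0 T"
      unfolding communication_def by (rule measurement_in_signals[OF h solves_L2[OF F[OF r]]])
  next
    fix s :: "('j, 'm \<times> 'l) signal" assume s: "s \<in> signals 0 T"
    define w where "w = F' (source h (time_reversal T s))"
    define z where "z x t = flip (w x (2 * T - t))" for x t
    have Ts: "time_reversal T s \<in> signals T (2 * T)"
      using s by (intro time_reversal_in_signals) (simp add: signals_def)
    have w: "solves T (2 * T) (source h (time_reversal T s)) w"
      unfolding w_def by (rule F'[OF Ts])
    have z: "(\<lambda>(x, t). z x t) \<in> L2 (\<Omega> \<times> {0..T})"
      using L2_linear[OF linear_flip L2_reflect_time[of w \<Omega> "2 * T" T 0]] solves_L2[OF w]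
      by (simp add: z_def case_prod_beta')
    have Cs: "?C s = measurement \<Omega> g z"
      by (simp add: communication_def time_reversal_measurement w_def[symmetric] z_def[abs_def])
    show "?C s \<in> signals 0 T" unfolding Cs by (rule measurement_in_signals[OF g z])
    fix r :: "('k, 'm \<times> 'l) signal" assume r: "r \<in> signals 0 T"
    define u where "u = F (source g r)"
    have u: "solves 0 T (source g r) u" unfolding u_def by (rule F[OF r])
    have "signal_inner 0 T (communication \<Omega> F g h r) s
        = set_lebesgue_integral lborel (\<Omega> \<times> {0..T}) (\<lambda>(x, t). u x t \<bullet> source h s x t)"
      using signal_inner_measurement[OF h solves_L2[OF u] s] by (simp add: communication_def u_def)
    also have "\<dots> = set_lebesgue_integral lborel (\<Omega> \<times> {0..T}) (\<lambda>(x, t). source g r x t \<bullet> z x t)"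
      using duality[OF u w L2_source[OF g r] L2_source[OF h Ts]]
      by (simp add: flip_source_time_reversal z_def)
    also have "\<dots> = signal_inner 0 T r (?C s)"
      unfolding Cs signal_inner_commute[of 0 T r] signal_inner_measurement[of g, OF g z r]
      by (simp add: inner_commute)
    finally show "signal_inner 0 T (communication \<Omega> F g h r) s = signal_inner 0 T r (?C s)" .
  qed
  then show ?thesis using is_adjoint_unique[OF adj] by (simp add: adjoint_equals_def)
qed

end

text \<open>\<open>frechet_derivative\<close> is a choice that carries information only at points of
  differentiability. This lemma takes the components of a state out of a partial derivative.\<close>

lemma partial_linear:
  assumes "bounded_linear h" "f differentiable (at x)"
  shows "partial i (\<lambda>y. h (f y)) x = h (partial i f x)"
proof -
  have "(f has_derivative frechet_derivative f (at x)) (at x)"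
    using assms(2) by (simp add: frechet_derivative_works)
  from frechet_derivative_at[OF bounded_linear.has_derivative[OF assms(1) this]]
  show ?thesis unfolding partial_def by metis
qed

lemmas partial_fst = partial_linear[OF bounded_linear_fst]
  and partial_snd = partial_linear[OF bounded_linear_snd]

section \<open>The acoustic and electromagnetic systems\<close>

text \<open>The matrix of the i-th partial derivative: the sum over \<open>i\<close> gives the pair
  of the gradient of \<open>p\<close> and the divergence of \<open>v\<close>.\<close>

definition acoustic_flux :: "3 \<Rightarrow> (real^3) \<times> real \<Rightarrow> (real^3) \<times> real" where
  "acoustic_flux i = (\<lambda>(v, p). (p *\<^sub>R axis i 1, v $ i))"

text \<open>This comes from writing the curl of w as the sum of the cross products of e_i with the
  i-th partial derivative of w. Crossing with e_i is skew, so the opposite signs of the two blocks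
  make the block matrix symmetric.\<close>

definition em_flux :: "3 \<Rightarrow> (real^3) \<times> (real^3) \<Rightarrow> (real^3) \<times> (real^3)" where
  "em_flux i = (\<lambda>(E, H). (- (cross3 (axis i 1) H), cross3 (axis i 1) E))"

lemma sum_acoustic_flux:
  "(\<Sum>i\<in>UNIV. acoustic_flux i (D i)) = (\<chi> i. snd (D i), \<Sum>i\<in>UNIV. fst (D i) $ i)"
  by (rule prod_eqI)
     (simp_all add: acoustic_flux_def fst_sum snd_sum case_prod_beta' vec_eq_iff sum_component axis_def
       if_distrib cong: if_cong)

lemma curl_eq_cross: "curl w x = (\<Sum>i\<in>UNIV. cross3 (axis i 1) (partial i w x))"
  by (simp add: curl_def cross3_def sum_3 vec_eq_iff forall_3 axis_def)

lemma sum_em_flux: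
  "(\<Sum>i\<in>UNIV. em_flux i (D i))
    = (- (\<Sum>i\<in>UNIV. cross3 (axis i 1) (snd (D i))), \<Sum>i\<in>UNIV. cross3 (axis i 1) (fst (D i)))"
  by (rule prod_eqI) (simp_all add: em_flux_def fst_sum snd_sum case_prod_beta' sum_negf)

text \<open>The flux exchanges the two components and so anticommutes with \<open>flip\<close>,
  whereas the block diagonal tensor commutes with it. The electromagnetic system has the same block
  structure, with \<open>S\<close> also block diagonal.\<close>

lemma time_reversible_acoustic:
  assumes "open \<Omega>" "material_tensor \<Omega> (acoustic_tensor \<rho> \<kappa>)"
  shows "time_reversible_system \<Omega> (acoustic_tensor \<rho> \<kappa>) (\<lambda>_ _. 0) acoustic_flux"
proof (rule time_reversible_system.intro)
  show "linear (acoustic_flux i)" for i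
    by (rule linearI) (auto simp: acoustic_flux_def algebra_simps)
  show "acoustic_flux i \<xi> \<bullet> \<eta> = \<xi> \<bullet> acoustic_flux i \<eta>" for i \<xi> \<eta>
    by (cases \<xi>; cases \<eta>) (simp add: acoustic_flux_def inner_axis inner_axis' mult.commute)
qed (use assms in \<open>auto simp: acoustic_flux_def acoustic_tensor_def flip_def zero_prod_def
    case_prod_beta'\<close>)

lemma time_reversible_em:
  assumes "open \<Omega>" "material_tensor \<Omega> (em_tensor \<epsilon> \<mu>)" "conductivity \<Omega> \<sigma>"
  shows "time_reversible_system \<Omega> (em_tensor \<epsilon> \<mu>) (\<lambda>x (E, H). (\<sigma> x *v E, 0)) em_flux"
proof (rule time_reversible_system.intro)
  show "linear (em_flux i)" for i
    by (rule linearI) (auto simp: em_flux_def cross_add_right cross_mult_right)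
  show "em_flux i \<xi> \<bullet> \<eta> = \<xi> \<bullet> em_flux i \<eta>" for i \<xi> \<eta>
    by (cases \<xi>; cases \<eta>) (simp add: em_flux_def cross3_simps)
  show "(case \<xi> of (E, H) \<Rightarrow> (\<sigma> x *v E, 0)) \<bullet> \<eta> = \<xi> \<bullet> (case \<eta> of (E, H) \<Rightarrow> (\<sigma> x *v E, 0))"
    if "x \<in> \<Omega>" for x \<xi> \<eta>
  proof -
    have "transpose (\<sigma> x) = \<sigma> x" using assms(3) that by (simp add: conductivity_def)
    then have "(\<sigma> x *v E) \<bullet> E' = E \<bullet> (\<sigma> x *v E')" for E E'
      using dot_lmul_matrix[of E "\<sigma> x" E'] by (metis vector_transpose_matrix)
    then show ?thesis by (cases \<xi>; cases \<eta>) simp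
  qed
qed (use assms in \<open>auto simp: em_flux_def em_tensor_def flip_def case_prod_beta'
    linear_neg[OF matrix_vector_mul_linear]\<close>)

section \<open>From the componentwise equations to the abstract system\<close>

lemma acoustic_solves_imp_solves:
  assumes "open \<Omega>" "material_tensor \<Omega> (acoustic_tensor \<rho> \<kappa>)" and u: "acoustic_solves \<Omega> \<rho> \<kappa> a b q u"
  shows "time_reversible_system.solves \<Omega> (acoustic_tensor \<rho> \<kappa>) (\<lambda>_ _. 0) acoustic_flux a b q u"
proof -
  interpret time_reversible_system \<Omega> "acoustic_tensor \<rho> \<kappa>" "\<lambda>_ _. 0" acoustic_flux
    by (rule time_reversible_acoustic[OF assms(1,2)])
  obtain u' where u': "regular_field \<Omega> a b u u'" "\<forall>x\<in>\<Omega>. u x a = 0"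
    and eq: "AE (x, t) in lborel. x \<in> \<Omega> \<and> t \<in> {a..b} \<longrightarrow>
          \<rho> x *\<^sub>R fst (u' x t) + grad (\<lambda>y. snd (u y t)) x = fst (q x t) \<and>
          \<kappa> x * snd (u' x t) + divergence (\<lambda>y. fst (u y t)) x = snd (q x t)"
    using u unfolding acoustic_solves_def by blast
  \<comment> \<open>Differentiability of the whole state lets its components pass through
    \<open>partial\<close>; the summand 0 below is the absent damping term.\<close>
  have "(\<lambda>y. u y t) differentiable (at x)" if "x \<in> \<Omega>" "t \<in> {a..b}" for x t
    using u'(1) that by (simp add: regular_field_def)
  with eq have "AE (x, t) in lborel. x \<in> \<Omega> \<and> t \<in> {a..b} \<longrightarrow>
      acoustic_tensor \<rho> \<kappa> x (u' x t) + (\<Sum>i\<in>UNIV. acoustic_flux i (partial i (\<lambda>y. u y t) x)) + 0 = q x t"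
    by (elim eventually_mono)
       (auto simp: sum_acoustic_flux acoustic_tensor_def case_prod_beta' grad_def divergence_def
         partial_fst partial_snd prod_eq_iff)
  with u u' show ?thesis unfolding solves_def acoustic_solves_def by blast
qed

lemma em_solves_imp_solves:
  assumes "open \<Omega>" "material_tensor \<Omega> (em_tensor \<epsilon> \<mu>)" "conductivity \<Omega> \<sigma>"
    and u: "em_solves \<Omega> \<epsilon> \<mu> \<sigma> a b q u"
  shows "time_reversible_system.solves \<Omega> (em_tensor \<epsilon> \<mu>) (\<lambda>x (E, H). (\<sigma> x *v E, 0)) em_flux a b q u"
proof -
  interpret time_reversible_system \<Omega> "em_tensor \<epsilon> \<mu>" "\<lambda>x (E, H). (\<sigma> x *v E, 0)" em_flux
    by (rule time_reversible_em[OF assms(1-3)])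
  obtain u' where u': "regular_field \<Omega> a b u u'" "\<forall>x\<in>\<Omega>. u x a = 0"
    and eq: "AE (x, t) in lborel. x \<in> \<Omega> \<and> t \<in> {a..b} \<longrightarrow>
          \<epsilon> x *v fst (u' x t) - curl (\<lambda>y. snd (u y t)) x + \<sigma> x *v fst (u x t) = fst (q x t) \<and>
          \<mu> x *v snd (u' x t) + curl (\<lambda>y. fst (u y t)) x = snd (q x t)"
    using u unfolding em_solves_def by blast
  have "(\<lambda>y. u y t) differentiable (at x)" if "x \<in> \<Omega>" "t \<in> {a..b}" for x t
    using u'(1) that by (simp add: regular_field_def)
  with eq have "AE (x, t) in lborel. x \<in> \<Omega> \<and> t \<in> {a..b} \<longrightarrow>
      em_tensor \<epsilon> \<mu> x (u' x t) + (\<Sum>i\<in>UNIV. em_flux i (partial i (\<lambda>y. u y t) x))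
        + (case u x t of (E, H) \<Rightarrow> (\<sigma> x *v E, 0)) = q x t"
    by (elim eventually_mono)
       (auto simp: sum_em_flux em_tensor_def case_prod_beta' curl_eq_cross
         partial_fst partial_snd prod_eq_iff)
  with u u' show ?thesis unfolding solves_def em_solves_def by blast
qed

text \<open>The choice returns some solution, which is all that \<open>adjoint_communication\<close>
  asks of the solution operator.\<close>

lemma solution_operator_solves:
  "solvable_on solves Q \<Longrightarrow> q \<in> Q \<Longrightarrow> solves q (solution_operator solves q)"
  unfolding solvable_on_def solution_operator_def by (rule someI_ex[of "solves q"]) blast

theorem theorem12p2:
  fixes \<Omega> :: "(real^3) set" and T :: real
    and dh :: "'j::finite \<Rightarrow> real^3" and d :: "'k::finite \<Rightarrow> real^3"
    and \<gamma>h :: "'j \<Rightarrow> real^3 \<Rightarrow> real" and \<gamma> :: "'k \<Rightarrow> real^3 \<Rightarrow> real"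
    and \<rho> \<kappa> :: "real^3 \<Rightarrow> real" and \<epsilon> \<mu> \<sigma> :: "real^3 \<Rightarrow> real^3^3"
  assumes "open \<Omega>" "connected \<Omega>" "\<Omega> \<noteq> {}" and "0 < T"
    and "antenna_profiles \<Omega> dh d \<gamma>h \<gamma>"
  shows
    "(material_tensor \<Omega> (acoustic_tensor \<rho> \<kappa>) \<and>
      solvable_on (acoustic_solves \<Omega> \<rho> \<kappa> 0 T) (source \<gamma> ` signals 0 T) \<and>
      solvable_on (acoustic_solves \<Omega> \<rho> \<kappa> T (2 * T)) (source \<gamma>h ` signals T (2 * T)) \<longrightarrow>
      adjoint_equals 0 T
        (communication \<Omega> (solution_operator (acoustic_solves \<Omega> \<rho> \<kappa> 0 T)) \<gamma> \<gamma>h)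
        (time_reversal T \<circ>
         communication \<Omega> (solution_operator (acoustic_solves \<Omega> \<rho> \<kappa> T (2 * T))) \<gamma>h \<gamma> \<circ>
         time_reversal T))
     \<and>
     (material_tensor \<Omega> (em_tensor \<epsilon> \<mu>) \<and> conductivity \<Omega> \<sigma> \<and>
      solvable_on (em_solves \<Omega> \<epsilon> \<mu> \<sigma> 0 T) (source \<gamma> ` signals 0 T) \<and>
      solvable_on (em_solves \<Omega> \<epsilon> \<mu> \<sigma> T (2 * T)) (source \<gamma>h ` signals T (2 * T)) \<longrightarrow>
      adjoint_equals 0 T
        (communication \<Omega> (solution_operator (em_solves \<Omega> \<epsilon> \<mu> \<sigma> 0 T)) \<gamma> \<gamma>h)
        (time_reversal T \<circ>
         communication \<Omega> (solution_operator (em_solves \<Omega> \<epsilon> \<mu> \<sigma> T (2 * T))) \<gamma>h \<gamma> \<circ>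
         time_reversal T))"
proof (intro conjI impI; elim conjE)
  have L2: "\<gamma> k \<in> L2 \<Omega>" "\<gamma>h j \<in> L2 \<Omega>" for k j
    using assms(5) by (auto simp: antenna_profiles_def)
  {
    assume mt: "material_tensor \<Omega> (acoustic_tensor \<rho> \<kappa>)"
      and sol: "solvable_on (acoustic_solves \<Omega> \<rho> \<kappa> 0 T) (source \<gamma> ` signals 0 T)"
        "solvable_on (acoustic_solves \<Omega> \<rho> \<kappa> T (2 * T)) (source \<gamma>h ` signals T (2 * T))"
    interpret time_reversible_system \<Omega> "acoustic_tensor \<rho> \<kappa>" "\<lambda>_ _. 0" acoustic_flux
      by (rule time_reversible_acoustic[OF assms(1) mt])
    show "adjoint_equals 0 T
        (communication \<Omega> (solution_operator (acoustic_solves \<Omega> \<rho> \<kappa> 0 T)) \<gamma> \<gamma>h)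
        (time_reversal T \<circ>
         communication \<Omega> (solution_operator (acoustic_solves \<Omega> \<rho> \<kappa> T (2 * T))) \<gamma>h \<gamma> \<circ>
         time_reversal T)"
      using sol[THEN solution_operator_solves]
      by (intro adjoint_communication L2 acoustic_solves_imp_solves[OF assms(1) mt]) blast+
  }
  assume mt: "material_tensor \<Omega> (em_tensor \<epsilon> \<mu>)" and \<sigma>: "conductivity \<Omega> \<sigma>"
    and sol: "solvable_on (em_solves \<Omega> \<epsilon> \<mu> \<sigma> 0 T) (source \<gamma> ` signals 0 T)"
      "solvable_on (em_solves \<Omega> \<epsilon> \<mu> \<sigma> T (2 * T)) (source \<gamma>h ` signals T (2 * T))"
  interpret time_reversible_system \<Omega> "em_tensor \<epsilon> \<mu>" "\<lambda>x (E, H). (\<sigma> x *v E, 0)" em_flux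
    by (rule time_reversible_em[OF assms(1) mt \<sigma>])
  show "adjoint_equals 0 T
      (communication \<Omega> (solution_operator (em_solves \<Omega> \<epsilon> \<mu> \<sigma> 0 T)) \<gamma> \<gamma>h)
      (time_reversal T \<circ>
       communication \<Omega> (solution_operator (em_solves \<Omega> \<epsilon> \<mu> \<sigma> T (2 * T))) \<gamma>h \<gamma> \<circ>
       time_reversal T)"
    using sol[THEN solution_operator_solves]
    by (intro adjoint_communication L2 em_solves_imp_solves[OF assms(1) mt \<sigma>]) blast+
qed

end
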